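(* There exist universal constants $L>0$, $b>0$ such that for every even integer $\alpha\ge2$ and every $t>0$, $$\max\Big\{\mathbb{P}(|\mathbb{H}^{(2)}_\alpha(0)|>t),\ \mathbb{P}(|\mathbb{H}^{(3)}_\alpha(0)|>t),\ \mathbb{P}(h^*_{\alpha;-}>t),\ \mathbb{P}(h^*_{\alpha;+}>t)\Big\}\le L\exp(-t^b/L).$$
   Context: $\mathbb{B}$ is a standard two-sided Brownian motion with $\mathbb{B}(0)=0$. For an even integer $\alpha\ge2$, $\mathbb{Y}_\alpha(t)=\int_0^t\mathbb{B}(s)ds+t^{\alpha+2}$, and $\mathbb{H}_\alpha$ is the almost surely uniquely defined random continuous function with $\mathbb{H}_\alpha(t)\ge\mathbb{Y}_\alpha(t)$ for all $t$, convex second derivative $\mathbb{H}_\alpha^{(2)}$, and $\int_{-\infty}^\infty(\mathbb{H}_\alpha-\mathbb{Y}_\alpha)\,d\mathbb{H}_\alpha^{(3)}=0$. $h^*_{\alpha;-}$ (resp. $h^*_{\alpha;+}$) is the absolute value of the location of the first touch point (point where $\mathbb{H}_\alpha=\mathbb{Y}_\alpha$) to the left (resp. right) of $0$. *)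

theory Defs
  imports "HOL-Probability.Probability"
begin

definition two_sided_BM :: "'a measure \<Rightarrow> ('a \<Rightarrow> real \<Rightarrow> real) \<Rightarrow> bool" where
  "two_sided_BM M B \<longleftrightarrow>
     prob_space M \<and>
     (\<forall>t. (\<lambda>\<omega>. B \<omega> t) \<in> borel_measurable M) \<and>
     (AE \<omega> in M. B \<omega> 0 = 0 \<and> continuous_on UNIV (B \<omega>)) \<and>
     (\<forall>ts :: real list. sorted_wrt (<) ts \<longrightarrow>
        prob_space.indep_vars M (\<lambda>_. borel)
          (\<lambda>i \<omega>. B \<omega> (ts ! Suc i) - B \<omega> (ts ! i)) {..<length ts - 1} \<and>
        (\<forall>i < length ts - 1.
           distributed M lborel (\<lambda>\<omega>. B \<omega> (ts ! Suc i) - B \<omega> (ts ! i))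
             (\<lambda>x. ennreal (normal_density 0 (sqrt (ts ! Suc i - ts ! i)) x))))"

definition Yproc :: "nat \<Rightarrow> (real \<Rightarrow> real) \<Rightarrow> real \<Rightarrow> real" where
  "Yproc \<alpha> b t = (LBINT s=0..t. b s) + t ^ (\<alpha> + 2)"

text \<open>Right derivative (used for the third derivative of H, which is the
  right derivative of the convex function H'').\<close>
definition rderiv :: "(real \<Rightarrow> real) \<Rightarrow> real \<Rightarrow> real" where
  "rderiv f x = Lim (at_right x) (\<lambda>y. (f y - f x) / (y - x))"

definition deriv2 :: "(real \<Rightarrow> real) \<Rightarrow> real \<Rightarrow> real" where
  "deriv2 h = deriv (deriv h)"

definition deriv3 :: "(real \<Rightarrow> real) \<Rightarrow> real \<Rightarrow> real" where
  "deriv3 h = rderiv (deriv2 h)"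

text \<open>h is the invelope of Y: h \<ge> Y, h'' exists and is convex, and
  \<integral> (h - Y) dh''' = 0 (Lebesgue-Stieltjes integral w.r.t. the nondecreasing,
  right-continuous function h''').\<close>
definition invelope :: "(real \<Rightarrow> real) \<Rightarrow> (real \<Rightarrow> real) \<Rightarrow> bool" where
  "invelope Y h \<longleftrightarrow>
     (\<forall>t. Y t \<le> h t) \<and>
     (\<forall>t. h differentiable (at t)) \<and>
     (\<forall>t. deriv h differentiable (at t)) \<and>
     convex_on UNIV (deriv2 h) \<and>
     (\<integral>\<^sup>+ t. ennreal (h t - Y t) \<partial>(interval_measure (deriv3 h))) = 0"

definition hplus :: "(real \<Rightarrow> real) \<Rightarrow> (real \<Rightarrow> real) \<Rightarrow> real" where
  "hplus Y h = Inf {s. 0 < s \<and> h s = Y s}"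

definition hminus :: "(real \<Rightarrow> real) \<Rightarrow> (real \<Rightarrow> real) \<Rightarrow> real" where
  "hminus Y h = Inf {s. 0 < s \<and> h (- s) = Y (- s)}"

end

theory Submission
  imports Defs "HOL-Real_Asymp.Real_Asymp"
begin

text \<open>The argument is pathwise. If a path b satisfies |b(s)| <= R (1 + |s|) for all s, then all
  four quantities are at most 10^9 R^2, whatever the exponent of the drift. Off the touch points
  the third derivative of H is constant, so between consecutive touch points l < u the function H
  is the cubic Hermite interpolant of Y. The interpolation error of the drift at the midpoint is at
  least of order (u - l)^4 once (l, u) is long and close to the origin, while H >= Y bounds it by
  the error of the integrated path, which is of order R (u - l) (1 + u - l). Hence u - l is of order
  sqrt R, and H is bounded near 0 by a multiple of R^2; since the second derivative of H is convex,
  it and its right derivative are bounded at 0 as well. Finally, chaining over dyadic points shows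
  that the path condition fails with probability at most 16 exp (- R^2 / 1024).\<close>

section \<open>Convex functions and Hermite interpolation\<close>

text \<open>Uniformity in the exponent is one obstacle. On (-1, 1) the fourth derivative of
  t^(\<alpha> + 2) has no positive lower bound valid for all \<alpha>, so the drift gives no help
  there. For |t| \<ge> 1, however, it is at least 4!, whatever \<alpha> is. On an interval of length
  2 r meeting [-1, 1] it therefore dominates a multiple, of order 1 / r^2, of t^2 - 1; the negative
  part of this comparison function on (-1, 1) is harmless once r is large. The other obstacle is
  roughness: an integrated Brownian path is merely continuously differentiable, so no fourth-order
  error formula applies to it. Its interpolation error is estimated from the Lipschitz constant
  alone. This crude bound is quadratic in a long interval against the quartic gain from the drift,
  which is enough to limit the length. Since the bounds are quadratic in R and the tail in R is
  Gaussian, the result is an exponential tail: b = 1.\<close>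

lemma convex_slope_mono:
  fixes f :: "real \<Rightarrow> real"
  assumes f: "convex_on UNIV f" and xyz: "x < y" "y < z"
  shows "(f y - f x) / (y - x) \<le> (f z - f x) / (z - x)"
    and "(f z - f x) / (z - x) \<le> (f z - f y) / (z - y)"
proof -
  have flip: "(f u - f v) / (u - v) = (f v - f u) / (v - u)" for u v
    by (metis minus_diff_eq minus_divide_divide)
  show "(f y - f x) / (y - x) \<le> (f z - f x) / (z - x)"
    using convex_on_slope_le(1)[of UNIV f x z y] f xyz by (simp add: flip[of x])
  show "(f z - f x) / (z - x) \<le> (f z - f y) / (z - y)"
    using convex_on_slope_le(2)[of UNIV f x z y] f xyz by (simp add: flip[of _ z])
qed

lemma rolle_deriv_zero:
  fixes \<phi> :: "real \<Rightarrow> real"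
  assumes "a < b" "\<phi> a = \<phi> b"
    and "\<And>t. t \<in> {a..b} \<Longrightarrow> (\<phi> has_real_derivative \<phi>' t) (at t)"
  obtains z where "a < z" "z < b" "\<phi>' z = 0"
proof -
  have "continuous_on {a..b} \<phi>"
    using assms(3) by (meson DERIV_continuous_on has_field_derivative_at_within)
  then obtain z where z: "a < z" "z < b" "(\<phi> has_real_derivative 0) (at z)"
    using Rolle[of a b \<phi>] assms real_differentiable_def
    by (metis atLeastAtMost_iff less_imp_le)
  then show ?thesis
    using that DERIV_unique[OF z(3)] assms(3)[of z] by auto
qed

text \<open>Repeated Rolle: subtracting the multiple \<open>c\<close> of (t - a)^2 (t - b)^2 that
  creates an extra zero at x leaves a function whose fourth derivative vanishes somewhere, so
  \<open>e4\<close> equals 24 c there and c inherits its sign. The third and fourth derivatives are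
  required only inside the interval because the second derivative of an invelope may have kinks at
  touch points.\<close>

lemma hermite_remainder_nonneg:
  fixes e :: "real \<Rightarrow> real"
  assumes x: "a < x" "x < b"
    and e: "\<And>t. t \<in> {a..b} \<Longrightarrow> (e has_real_derivative e1 t) (at t)"
    and e1: "\<And>t. t \<in> {a..b} \<Longrightarrow> (e1 has_real_derivative e2 t) (at t)"
    and e2: "\<And>t. t \<in> {a<..<b} \<Longrightarrow> (e2 has_real_derivative e3 t) (at t)"
    and e3: "\<And>t. t \<in> {a<..<b} \<Longrightarrow> (e3 has_real_derivative e4 t) (at t)"
    and ends: "e a = 0" "e b = 0" "e1 a = 0" "e1 b = 0"
    and nonneg: "\<And>t. t \<in> {a<..<b} \<Longrightarrow> 0 \<le> e4 t"
  shows "0 \<le> e x"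
proof -
  define c where "c = e x / ((x - a)^2 * (x - b)^2)"
  define p0 where "p0 t = e t - c * ((t - a)^2 * (t - b)^2)" for t
  define p1 where "p1 t = e1 t - c * (2 * ((t - a) * (t - b)) * ((t - a) + (t - b)))" for t
  define p2 where "p2 t = e2 t - c * (2 * ((t - a) + (t - b))^2 + 4 * ((t - a) * (t - b)))" for t
  define p3 where "p3 t = e3 t - c * (12 * ((t - a) + (t - b)))" for t
  define p4 where "p4 t = e4 t - c * 24" for t
  have D0: "(p0 has_real_derivative p1 t) (at t)" if "t \<in> {a..b}" for t
    unfolding p0_def[abs_def] p1_def
    by (auto intro!: derivative_eq_intros e[OF that] simp: algebra_simps power2_eq_square)
  have D1: "(p1 has_real_derivative p2 t) (at t)" if "t \<in> {a..b}" for t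
    unfolding p1_def[abs_def] p2_def
    by (auto intro!: derivative_eq_intros e1[OF that] simp: algebra_simps power2_eq_square)
  have D2: "(p2 has_real_derivative p3 t) (at t)" if "t \<in> {a<..<b}" for t
    unfolding p2_def[abs_def] p3_def
    by (auto intro!: derivative_eq_intros e2[OF that] simp: algebra_simps power2_eq_square)
  have D3: "(p3 has_real_derivative p4 t) (at t)" if "t \<in> {a<..<b}" for t
    unfolding p3_def[abs_def] p4_def
    by (auto intro!: derivative_eq_intros e3[OF that] simp: algebra_simps power2_eq_square)
  have z: "p0 a = 0" "p0 b = 0" "p1 a = 0" "p1 b = 0" "p0 x = 0"
    using x ends by (auto simp: p0_def p1_def c_def)
  obtain u1 where u1: "a < u1" "u1 < x" "p1 u1 = 0"
    using rolle_deriv_zero[of a x p0 p1] x z D0 by auto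
  obtain u2 where u2: "x < u2" "u2 < b" "p1 u2 = 0"
    using rolle_deriv_zero[of x b p0 p1] x z D0 by auto
  \<comment> \<open>The double zeros at the ends join the two Rolle points: \<open>p1\<close>
    vanishes at a < u1 < u2 < b, hence \<open>p2\<close> three times, \<open>p3\<close> twice and
    \<open>p4\<close> once.\<close>
  obtain v1 where v1: "a < v1" "v1 < u1" "p2 v1 = 0"
    using rolle_deriv_zero[of a u1 p1 p2] x z D1 u1 u2 by auto
  obtain v2 where v2: "u1 < v2" "v2 < u2" "p2 v2 = 0"
    using rolle_deriv_zero[of u1 u2 p1 p2] x z D1 u1 u2 by auto
  obtain v3 where v3: "u2 < v3" "v3 < b" "p2 v3 = 0"
    using rolle_deriv_zero[of u2 b p1 p2] x z D1 u1 u2 by auto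
  obtain w1 where w1: "v1 < w1" "w1 < v2" "p3 w1 = 0"
    using rolle_deriv_zero[of v1 v2 p2 p3] D2 v1 v2 v3 u1 u2 by auto
  obtain w2 where w2: "v2 < w2" "w2 < v3" "p3 w2 = 0"
    using rolle_deriv_zero[of v2 v3 p2 p3] D2 v1 v2 v3 u1 u2 by auto
  obtain y where y: "w1 < y" "y < w2" "p4 y = 0"
    using rolle_deriv_zero[of w1 w2 p3 p4] D3 v1 v2 v3 u1 u2 w1 w2 by auto
  have "0 \<le> e4 y" using nonneg y w1 w2 v1 v3 by auto
  then have "0 \<le> c" using y by (simp add: p4_def)
  moreover have "e x = c * ((x - a)^2 * (x - b)^2)"
    using x by (simp add: c_def)
  ultimately show ?thesis by simp
qed

lemma concave_below_tangent:
  fixes \<phi> :: "real \<Rightarrow> real"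
  assumes "s < t"
    and \<phi>: "\<And>u. u \<in> {s..t} \<Longrightarrow> (\<phi> has_real_derivative \<phi>1 u) (at u)"
    and \<phi>1: "\<And>u. u \<in> {s..t} \<Longrightarrow> (\<phi>1 has_real_derivative \<phi>2 u) (at u)"
    and neg: "\<And>u. u \<in> {s..t} \<Longrightarrow> \<phi>2 u \<le> 0"
  shows "\<phi> t \<le> \<phi> s + \<phi>1 s * (t - s)"
proof -
  obtain x where x: "s < x" "x < t" "\<phi> t - \<phi> s = (t - s) * \<phi>1 x"
    using MVT2[of s t \<phi> \<phi>1] assms by auto
  obtain y where y: "s < y" "y < x" "\<phi>1 x - \<phi>1 s = (x - s) * \<phi>2 y"
    using MVT2[of s x \<phi>1 \<phi>2] assms x by auto
  have "\<phi>1 x \<le> \<phi>1 s"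
    using y x neg[of y] mult_nonneg_nonpos[of "x - s" "\<phi>2 y"] by auto
  then have "(t - s) * \<phi>1 x \<le> (t - s) * \<phi>1 s"
    using assms(1) by (intro mult_left_mono) auto
  then show ?thesis using x by (simp add: algebra_simps)
qed

text \<open>\<open>rderiv\<close> is a \<open>Lim\<close>, informative only once convergence is
  known. Slopes from x shrink as y decreases to x and stay above any slope ending at x, so their
  infimum is the limit.\<close>

lemma convex_rderiv_tendsto:
  fixes f :: "real \<Rightarrow> real"
  assumes f: "convex_on UNIV f"
  shows "((\<lambda>y. (f y - f x) / (y - x)) \<longlongrightarrow> rderiv f x) (at_right x)"
proof -
  define q where "q y = (f y - f x) / (y - x)" for y
  define l where "l = (INF y\<in>{x<..}. q y)"
  have lower: "f x - f (x - 1) \<le> q y" if "x < y" for y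
    using convex_slope_mono[OF f, of "x - 1" x y] that unfolding q_def by auto
  have bdd: "bdd_below (q ` {x<..})" using lower by (auto intro!: bdd_belowI)
  have "(q \<longlongrightarrow> l) (at_right x)"
  proof (rule order_tendstoI)
    fix e assume "e < l"
    have "l \<le> q y" if "x < y" for y
      unfolding l_def using bdd that by (auto intro: cINF_lower)
    then show "\<forall>\<^sub>F y in at_right x. e < q y"
      using \<open>e < l\<close> less_le_trans by (intro eventually_at_rightI[of x "x + 1"]) auto
  next
    fix e assume "l < e"
    then obtain z where z: "x < z" "q z < e"
      unfolding l_def using cINF_less_iff[of "{x<..}" q e] bdd by auto
    have "q y < e" if "x < y" "y < z" for y
      using convex_slope_mono(1)[OF f that] z unfolding q_def by auto
    then show "\<forall>\<^sub>F y in at_right x. q y < e"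
      using z by (intro eventually_at_rightI[of x z]) auto
  qed
  moreover from this have "rderiv f x = l"
    unfolding rderiv_def q_def[abs_def] by (intro tendsto_Lim) auto
  ultimately show ?thesis
    unfolding q_def[abs_def] by simp
qed

lemma convex_rderiv_le_slope:
  fixes f :: "real \<Rightarrow> real"
  assumes f: "convex_on UNIV f" and "x < y"
  shows "rderiv f x \<le> (f y - f x) / (y - x)"
  by (rule tendsto_upperbound[OF convex_rderiv_tendsto[OF f]])
     (use assms convex_slope_mono(1)[OF f] in \<open>auto intro!: eventually_at_rightI[of x y]\<close>)

lemma convex_slope_le_rderiv:
  fixes f :: "real \<Rightarrow> real"
  assumes f: "convex_on UNIV f" and "x < y"
  shows "(f y - f x) / (y - x) \<le> rderiv f y"
proof (rule tendsto_lowerbound[OF convex_rderiv_tendsto[OF f]])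
  have "(f y - f x) / (y - x) \<le> (f z - f y) / (z - y)" if "y < z" for z
    using convex_slope_mono[OF f \<open>x < y\<close> that] by linarith
  then show "\<forall>\<^sub>F z in at_right y. (f y - f x) / (y - x) \<le> (f z - f y) / (z - y)"
    by (intro eventually_at_rightI[of y "y + 1"]) auto
qed auto

lemma convex_rderiv_mono:
  fixes f :: "real \<Rightarrow> real"
  assumes f: "convex_on UNIV f" and "x \<le> y"
  shows "rderiv f x \<le> rderiv f y"
  using convex_rderiv_le_slope[OF f, of x y] convex_slope_le_rderiv[OF f, of x y] assms(2)
  by (cases "x = y") auto

text \<open>Needed for \<open>interval_measure\<close> to give (s, t] the increment of the right
  derivative. For the upper estimate, fix z with slope from x to z below e:
  \<open>rderiv f y\<close> is at most the slope from y to z, which is continuous in y.\<close>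

lemma convex_rderiv_right_continuous:
  fixes f :: "real \<Rightarrow> real"
  assumes f: "convex_on UNIV f"
  shows "continuous (at_right x) (rderiv f)"
  unfolding continuous_within
proof (rule order_tendstoI)
  fix e assume "e < rderiv f x"
  then have "e < rderiv f y" if "x < y" for y
    using convex_rderiv_mono[OF f, of x y] that by linarith
  then show "\<forall>\<^sub>F y in at_right x. e < rderiv f y"
    by (intro eventually_at_rightI[of x "x + 1"]) auto
next
  fix e assume "rderiv f x < e"
  then have "\<forall>\<^sub>F z in at_right x. (f z - f x) / (z - x) < e"
    using convex_rderiv_tendsto[OF f, of x] order_tendstoD(2) by blast
  then obtain c where c: "x < c" "\<And>z. x < z \<Longrightarrow> z < c \<Longrightarrow> (f z - f x) / (z - x) < e"
    unfolding eventually_at_right_field by blast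
  then obtain z where z: "x < z" "(f z - f x) / (z - x) < e"
    using dense[of x c] by blast
  have cont: "isCont f y" for y
    using convex_on_continuous[OF open_UNIV f] by (simp add: continuous_on_eq_continuous_at)
  have "((\<lambda>y. (f z - f y) / (z - y)) \<longlongrightarrow> (f z - f x) / (z - x)) (at_right x)"
    using cont[of x] z
    by (intro tendsto_intros) (auto simp: isCont_def intro: tendsto_within_subset)
  then have "\<forall>\<^sub>F y in at_right x. (f z - f y) / (z - y) < e"
    using z order_tendstoD(2) by blast
  moreover have "\<forall>\<^sub>F y in at_right x. y < z"
    using z by (intro eventually_at_rightI[of x z]) auto
  ultimately show "\<forall>\<^sub>F y in at_right x. rderiv f y < e"
    by eventually_elim (use convex_rderiv_le_slope[OF f] in fastforce)
qed

lemma lipschitz_from_deriv: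
  fixes W :: "real \<Rightarrow> real"
  assumes "s \<le> t" and W: "\<And>u. u \<in> {s..t} \<Longrightarrow> (W has_real_derivative v u) (at u)"
    and K: "\<And>u. u \<in> {s..t} \<Longrightarrow> \<bar>v u\<bar> \<le> K"
  shows "\<bar>W t - W s\<bar> \<le> K * (t - s)"
proof (cases "s = t")
  case False
  then obtain z where z: "s < z" "z < t" "W t - W s = (t - s) * v z"
    using MVT2[of s t W v] assms by auto
  then have "\<bar>W t - W s\<bar> = \<bar>v z\<bar> * (t - s)" by (simp add: abs_mult)
  also have "\<dots> \<le> K * (t - s)" using z K[of z] by (intro mult_right_mono) auto
  finally show ?thesis .
qed simp

text \<open>Only Lipschitz data enter, as the integrated path offers nothing better. With L = u - l,
  the linear, quadratic and cubic terms contribute at most 1, 6 and 4 times K L, hence 11.\<close>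

lemma cubic_hermite_interpolant:
  fixes l u K wl wu dl du :: real
  assumes "l < u" "\<bar>dl\<bar> \<le> K" "\<bar>du\<bar> \<le> K" "\<bar>wu - wl\<bar> \<le> K * (u - l)"
  obtains c2 c3 where
    "wl + dl * (u - l) + c2 * (u - l)^2 + c3 * (u - l)^3 = wu"
    "dl + 2 * c2 * (u - l) + 3 * c3 * (u - l)^2 = du"
    "\<And>t. t \<in> {l..u} \<Longrightarrow>
      wl + dl * (t - l) + c2 * (t - l)^2 + c3 * (t - l)^3 \<le> wl + 11 * K * (u - l)"
proof -
  define L where "L = u - l"
  define c2 where "c2 = 3 * (wu - wl) / L^2 - (2 * dl + du) / L"
  define c3 where "c3 = - 2 * (wu - wl) / L^3 + (dl + du) / L^2"
  have L: "0 < L" using assms by (simp add: L_def)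
  have K: "0 \<le> K" using assms by linarith
  have D: "\<bar>wu - wl\<bar> \<le> K * L" using assms by (simp add: L_def)
  have c2L: "c2 * L^2 = 3 * (wu - wl) - (2 * dl + du) * L"
    using L by (simp add: c2_def field_simps power2_eq_square)
  have c3L: "c3 * L^3 = - 2 * (wu - wl) + (dl + du) * L"
    using L by (simp add: c3_def field_simps power2_eq_square power3_eq_cube)
  have dL: "\<bar>dl * L\<bar> \<le> K * L" "\<bar>du * L\<bar> \<le> K * L"
    using assms L by (auto simp: abs_mult intro: mult_right_mono)
  have b2: "\<bar>c2 * L^2\<bar> \<le> 6 * (K * L)" and b3: "\<bar>c3 * L^3\<bar> \<le> 4 * (K * L)"
    unfolding c2L c3L using dL D by (auto simp: distrib_right)
  have 1: "wl + dl * L + c2 * L^2 + c3 * L^3 = wu"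
    unfolding c2L c3L by (simp add: algebra_simps)
  have "(dl + 2 * c2 * L + 3 * c3 * L^2) * L = dl * L + 2 * (c2 * L^2) + 3 * (c3 * L^3)"
    by (simp add: algebra_simps power2_eq_square power3_eq_cube)
  also have "\<dots> = du * L" unfolding c2L c3L by (simp add: algebra_simps)
  finally have 2: "dl + 2 * c2 * L + 3 * c3 * L^2 = du" using L by simp
  have 3: "dl * (t - l) + c2 * (t - l)^2 + c3 * (t - l)^3 \<le> 11 * K * L" if "t \<in> {l..u}" for t
  proof -
    have t: "0 \<le> t - l" "t - l \<le> L" using that by (auto simp: L_def)
    have pw: "x * (t - l)^k \<le> \<bar>x * L^k\<bar>" for x k
    proof -
      have "x * (t - l)^k \<le> \<bar>x\<bar> * (t - l)^k" using t by (intro mult_right_mono) auto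
      also have "\<dots> \<le> \<bar>x\<bar> * L^k" using t by (intro mult_left_mono power_mono) auto
      finally show ?thesis using L by (simp add: abs_mult)
    qed
    show ?thesis using pw[of dl 1] pw[of c2 2] pw[of c3 3] b2 b3 dL by simp
  qed
  show ?thesis
    using that[of c2 c3] 1 2 3 unfolding L_def by (simp add: algebra_simps)
qed

section \<open>Invelopes of paths of linear growth\<close>

text \<open>Deterministic interface: \<open>v\<close> is the path, \<open>W\<close> its integral,
  \<open>f\<close> the second derivative of \<open>h\<close>, and n = \<alpha> - 2, so that the
  fourth derivative of the drift is a multiple of t^n. The integral condition appears through its
  consequence \<open>affine\<close>, a form visibly stable under reflection.\<close>

locale controlled_invelope =
  fixes n :: nat and R :: real and v W h h1 f :: "real \<Rightarrow> real"
  assumes even: "even n"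
    and R: "1 \<le> R"
    and W: "(W has_real_derivative v t) (at t)"
    and W0: "W 0 = 0"
    and growth: "\<bar>v t\<bar> \<le> R * (1 + \<bar>t\<bar>)"
    and h: "(h has_real_derivative h1 t) (at t)"
    and h1: "(h1 has_real_derivative f t) (at t)"
    and convex: "convex_on UNIV f"
    and above: "W t + t ^ (n + 4) \<le> h t"
    and affine: "is_interval S \<Longrightarrow> (\<And>s. s \<in> S \<Longrightarrow> h s \<noteq> W s + s ^ (n + 4)) \<Longrightarrow>
      \<exists>c d. \<forall>s\<in>S. f s = c + d * s"
begin

definition touch :: "real \<Rightarrow> bool" where
  "touch t \<longleftrightarrow> h t = W t + t ^ (n + 4)"

text \<open>Transfers results on the right of 0 to the left; evenness of n keeps the drift
  unchanged.\<close>

lemma reflect: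
  "controlled_invelope n R (\<lambda>t. - v (- t)) (\<lambda>t. W (- t)) (\<lambda>t. h (- t))
    (\<lambda>t. - h1 (- t)) (\<lambda>t. f (- t))"
proof
  fix t :: real
  have m: "(uminus has_real_derivative - 1) (at t)"
    by (auto intro!: derivative_eq_intros)
  show "((\<lambda>t. W (- t)) has_real_derivative - v (- t)) (at t)"
    using DERIV_chain2[OF W m] by simp
  show "((\<lambda>t. h (- t)) has_real_derivative - h1 (- t)) (at t)"
    using DERIV_chain2[OF h m] by simp
  show "((\<lambda>t. - h1 (- t)) has_real_derivative f (- t)) (at t)"
    using DERIV_minus[OF DERIV_chain2[OF h1 m]] by simp
  show "\<bar>- v (- t)\<bar> \<le> R * (1 + \<bar>t\<bar>)" using growth[of "- t"] by simp
  show "W (- t) + t ^ (n + 4) \<le> h (- t)" using above[of "- t"] even by simp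
next
  show "convex_on UNIV (\<lambda>t. f (- t))"
  proof (rule convex_onI)
    fix t x y :: real assume "0 < t" "t < 1"
    then show "f (- ((1 - t) *\<^sub>R x + t *\<^sub>R y)) \<le> (1 - t) * f (- x) + t * f (- y)"
      using convex_onD[OF convex, of t "- x" "- y"] by (simp add: algebra_simps)
  qed auto
next
  fix S :: "real set"
  assume S: "is_interval S" "\<And>s. s \<in> S \<Longrightarrow> h (- s) \<noteq> W (- s) + s ^ (n + 4)"
  have "is_interval (uminus ` S)"
    using S(1) by simp
  moreover have "h s \<noteq> W s + s ^ (n + 4)" if "s \<in> uminus ` S" for s
    using that S(2) even by auto
  ultimately obtain c d where cd: "\<forall>s\<in>uminus ` S. f s = c + d * s"
    using affine by blast
  then have "\<forall>s\<in>S. f (- s) = c + (- d) * s" by auto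
  then show "\<exists>c d. \<forall>s\<in>S. f (- s) = c + d * s" by blast
qed (use even R W0 in auto)

lemma touch_reflect: "controlled_invelope.touch n (\<lambda>t. W (- t)) (\<lambda>t. h (- t)) t \<longleftrightarrow> touch (- t)"
  using even unfolding controlled_invelope.touch_def[OF reflect] touch_def by simp

lemma W_bound: "\<bar>W t\<bar> \<le> R * (1 + \<bar>t\<bar>) * \<bar>t\<bar>"
proof -
  have K: "\<bar>v u\<bar> \<le> R * (1 + \<bar>t\<bar>)" if "\<bar>u\<bar> \<le> \<bar>t\<bar>" for u
    using growth[of u] that R by (smt (verit) mult_left_mono)
  show ?thesis
    using lipschitz_from_deriv[of 0 t W v "R * (1 + \<bar>t\<bar>)"]
      lipschitz_from_deriv[of t 0 W v "R * (1 + \<bar>t\<bar>)"] W W0 K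
    by (cases "0 \<le> t") auto
qed

lemma cont: "continuous_on A h" "continuous_on A W" "continuous_on A f"
  using h W convex_on_continuous[OF open_UNIV convex]
  by (meson DERIV_continuous_on has_field_derivative_at_within continuous_on_subset subset_UNIV)+

lemma closed_touch: "closed {t. touch t}"
  unfolding touch_def by (intro closed_Collect_eq continuous_intros cont)

text \<open>At a touch point the nonnegative gap between h and its obstacle is minimal. So touching
  fixes slopes as well as values: full Hermite data at both ends of a touch-free interval.\<close>

lemma touch_deriv:
  assumes "touch t"
  shows "h1 t = v t + real (n + 4) * t ^ (n + 3)"
proof -
  have "((\<lambda>s. h s - (W s + s ^ (n + 4))) has_real_derivative
      h1 t - (v t + real (n + 4) * t ^ (n + 3))) (at t)"
    by (auto intro!: derivative_eq_intros h W simp: add.commute)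
  then have "h1 t - (v t + real (n + 4) * t ^ (n + 3)) = 0"
    by (rule DERIV_local_min[where d = 1]) (use assms above in \<open>auto simp: touch_def\<close>)
  then show ?thesis by simp
qed

text \<open>Beyond the last touch point h would be a cubic polynomial, too small to stay above
  a path of growth at least t^4.\<close>

lemma touch_right: "\<exists>t>x. touch t"
proof (rule ccontr)
  assume no: "\<not> (\<exists>t>x. touch t)"
  then obtain c d where cd: "\<forall>s\<in>{x<..}. f s = c + d * s"
    using affine[of "{x<..}"] by (auto simp: touch_def)
  \<comment> \<open>\<open>f\<close> is affine strictly to the right of x, so the tangent is taken
    at x + 1; there \<open>p\<close> has zero second derivative.\<close>
  define s where "s = x + 1"
  define p where "p t = h t - c * (t^2 / 2) - d * (t^3 / 6)" for t
  define p1 where "p1 t = h1 t - c * t - d * (t^2 / 2)" for t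
  have "p t \<le> p s + p1 s * (t - s)" if "s < t" for t
  proof (rule concave_below_tangent[OF that, of p p1 "\<lambda>t. f t - c - d * t"])
    show "(p has_real_derivative p1 u) (at u)" for u
      unfolding p_def[abs_def] p1_def by (auto intro!: derivative_eq_intros h)
    show "(p1 has_real_derivative f u - c - d * u) (at u)" for u
      unfolding p1_def[abs_def] by (auto intro!: derivative_eq_intros h1)
  qed (use cd in \<open>auto simp: s_def\<close>)
  then have up: "h t \<le> p s + p1 s * (t - s) + c * (t^2 / 2) + d * (t^3 / 6)" if "s < t" for t
    using that unfolding p_def by fastforce
  have "\<forall>\<^sub>F t in at_top. p s + p1 s * (t - s) + c * (t^2 / 2) + d * (t^3 / 6)
      < t^4 - R * (1 + t) * t"
    by real_asymp
  moreover have "\<forall>\<^sub>F t in at_top. max 1 s < t" by (rule eventually_gt_at_top)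
  ultimately have "\<forall>\<^sub>F t in at_top. max 1 s < t \<and>
      p s + p1 s * (t - s) + c * (t^2 / 2) + d * (t^3 / 6) < t^4 - R * (1 + t) * t"
    by eventually_elim auto
  then obtain t where t: "max 1 s < t"
      "p s + p1 s * (t - s) + c * (t^2 / 2) + d * (t^3 / 6) < t^4 - R * (1 + t) * t"
    using eventually_happens'[OF trivial_limit_at_top_linorder] by blast
  have "t^4 \<le> t^(n + 4)" using t by (intro power_increasing) auto
  moreover have "\<bar>W t\<bar> \<le> R * (1 + t) * t" using W_bound[of t] t by simp
  moreover have "h t \<le> p s + p1 s * (t - s) + c * (t^2 / 2) + d * (t^3 / 6)"
    using up[of t] t by simp
  ultimately show False
    using t(2) above[of t] by linarith
qed

lemma touch_left: "\<exists>t<x. touch t"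
  using controlled_invelope.touch_right[OF reflect, of "- x"]
  unfolding touch_reflect by (metis minus_less_iff)

section \<open>Touch-free intervals and their length\<close>

definition bracket :: "real \<Rightarrow> real \<Rightarrow> bool" where
  "bracket l u \<longleftrightarrow> l < u \<and> touch l \<and> touch u \<and> (\<forall>t\<in>{l<..<u}. \<not> touch t)"

lemma bracket_exists:
  assumes "\<not> touch x"
  obtains l u where "bracket l u" "l < x" "x < u"
proof -
  define U where "U = {t. touch t} \<inter> {x..}"
  define L where "L = {t. touch t} \<inter> {..x}"
  have cl: "closed U" "closed L"
    unfolding U_def L_def by (intro closed_Int closed_touch closed_atLeast closed_atMost)+
  have ne: "U \<noteq> {}" "L \<noteq> {}"
    using touch_right[of x] touch_left[of x] by (force simp: U_def L_def)+
  have bd: "bdd_below U" "bdd_above L"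
    by (auto simp: U_def L_def)
  have in_UL: "Inf U \<in> U" "Sup L \<in> L"
    using closed_contains_Inf[OF ne(1) bd(1) cl(1)] closed_contains_Sup[OF ne(2) bd(2) cl(2)] by auto
  have lt: "Sup L < x" "x < Inf U"
    using in_UL assms by (auto simp: U_def L_def less_le)
  have "\<not> touch t" if "Sup L < t" "t < Inf U" for t
  proof
    assume "touch t"
    then have "t \<in> U \<or> t \<in> L" by (auto simp: U_def L_def)
    then show False
      using that cInf_lower[OF _ bd(1)] cSup_upper[OF _ bd(2)] by force
  qed
  then show ?thesis
    using that[of "Sup L" "Inf U"] in_UL lt by (auto simp: bracket_def U_def L_def)
qed

text \<open>On a touch-free interval h is the cubic Hermite interpolant of its obstacle, so the
  interpolation error of the drift is controlled by that of W. The sextic \<open>q\<close>, with double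
  zeros at both ends and fourth derivative proportional to \<open>t^2 - 1\<close>, is a lower bound for
  the former that does not depend on n.\<close>

lemma bracket_estimate:
  assumes br: "bracket l u" and x: "l < x" "x < u"
    and K: "\<And>t. t \<in> {l..u} \<Longrightarrow> \<bar>v t\<bar> \<le> K"
    and \<kappa>: "\<And>t. t \<in> {l..u} \<Longrightarrow>
      \<kappa> * (360 * (t^2 - 1)) \<le> real ((n + 4) * (n + 3) * (n + 2) * (n + 1)) * t ^ n"
  defines "m \<equiv> (l + u) / 2" and "r \<equiv> (u - l) / 2"
  shows "h x - (W x + x ^ (n + 4)) +
      \<kappa> * (((x - m)^2 - r^2)^2 * ((x - m)^2 + 6 * m * (x - m) + 15 * (m^2 - 1) + 2 * r^2))
    \<le> 12 * K * (u - l)"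
proof -
  have lu: "l < u" "touch l" "touch u" and free: "\<And>t. t \<in> {l<..<u} \<Longrightarrow> \<not> touch t"
    using br by (auto simp: bracket_def)
  have lm: "l - m = - r" "u - m = r" by (auto simp: m_def r_def field_simps)
  obtain c d where cd: "\<forall>s\<in>{l<..<u}. f s = c + d * s"
    using affine[of "{l<..<u}"] free by (auto simp: touch_def)
  have f: "(f has_real_derivative d) (at t)" if "t \<in> {l<..<u}" for t
  proof (rule has_field_derivative_transform_within_open[of "\<lambda>s. c + d * s" d t "{l<..<u}"])
    show "((\<lambda>s. c + d * s) has_real_derivative d) (at t)"
      by (auto intro!: derivative_eq_intros)
  qed (use that cd in auto)
  have lip: "\<bar>W t - W s\<bar> \<le> K * (t - s)" if "l \<le> s" "s \<le> t" "t \<le> u" for s t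
    using that K by (intro lipschitz_from_deriv[where v = v] W) auto
  obtain c2 c3 where p: "W l + v l * (u - l) + c2 * (u - l)^2 + c3 * (u - l)^3 = W u"
    "v l + 2 * c2 * (u - l) + 3 * c3 * (u - l)^2 = v u"
    "\<And>t. t \<in> {l..u} \<Longrightarrow>
      W l + v l * (t - l) + c2 * (t - l)^2 + c3 * (t - l)^3 \<le> W l + 11 * K * (u - l)"
    using cubic_hermite_interpolant[of l u "v l" K "v u" "W u" "W l"] lu K lip by auto
  \<comment> \<open>With s = t - m, \<open>q\<close> is (s^2 - r^2)^2 (s^2 + 6 m s + g), expanded
    for differentiation. The coefficient 6 m and the value of \<open>g\<close> are forced by
    requiring \<open>q4\<close> to be 360 ((s + m)^2 - 1).\<close>
  define g where "g = 15 * (m^2 - 1) + 2 * r^2"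
  define q where "q s = s^6 + 6 * m * s^5 + (g - 2 * r^2) * s^4 - 12 * m * r^2 * s^3 + (r^4 - 2 * r^2 * g) * s^2
    + 6 * m * r^4 * s + r^4 * g" for s
  define q1 where "q1 s = 6 * s^5 + 30 * m * s^4 + 4 * (g - 2 * r^2) * s^3 - 36 * m * r^2 * s^2
    + 2 * (r^4 - 2 * r^2 * g) * s + 6 * m * r^4" for s
  define q2 where "q2 s = 30 * s^4 + 120 * m * s^3 + 12 * (g - 2 * r^2) * s^2 - 72 * m * r^2 * s
    + 2 * (r^4 - 2 * r^2 * g)" for s
  define q3 where "q3 s = 120 * s^3 + 360 * m * s^2 + 24 * (g - 2 * r^2) * s - 72 * m * r^2" for s
  define q4 where "q4 s = 360 * s^2 + 720 * m * s + 24 * (g - 2 * r^2)" for s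
  have q: "(q has_real_derivative q1 s) (at s)" "(q1 has_real_derivative q2 s) (at s)"
    "(q2 has_real_derivative q3 s) (at s)" "(q3 has_real_derivative q4 s) (at s)" for s
    unfolding q_def[abs_def] q1_def[abs_def] q2_def[abs_def] q3_def[abs_def] q4_def
    by (auto intro!: derivative_eq_intros simp: algebra_simps)
  have shift: "((\<lambda>t. t - m) has_real_derivative 1) (at t)" for t
    by (auto intro!: derivative_eq_intros)
  have qs: "((\<lambda>t. q (t - m)) has_real_derivative q1 (t - m)) (at t)"
    "((\<lambda>t. q1 (t - m)) has_real_derivative q2 (t - m)) (at t)"
    "((\<lambda>t. q2 (t - m)) has_real_derivative q3 (t - m)) (at t)"
    "((\<lambda>t. q3 (t - m)) has_real_derivative q4 (t - m)) (at t)" for t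
    using DERIV_chain2[OF q(1) shift] DERIV_chain2[OF q(2) shift] DERIV_chain2[OF q(3) shift]
      DERIV_chain2[OF q(4) shift] by simp_all
  have q4: "q4 (t - m) = 360 * (t^2 - 1)" for t
    unfolding q4_def g_def by (simp add: algebra_simps power2_eq_square)
  have q0: "q r = 0" "q (- r) = 0" "q1 r = 0" "q1 (- r) = 0"
    unfolding q_def q1_def by (simp_all add: algebra_simps eval_nat_numeral)
  define N where "N = real (n + 4)"
  have N: "real (n + 4) = N" "real (n + 3) = N - 1" "real (n + 2) = N - 2" "real (n + 1) = N - 3"
    by (simp_all add: N_def)
  have pw: "((\<lambda>t. t ^ (n + 4)) has_real_derivative N * t ^ (n + 3)) (at t)"
    "((\<lambda>t. t ^ (n + 3)) has_real_derivative (N - 1) * t ^ (n + 2)) (at t)"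
    "((\<lambda>t. t ^ (n + 2)) has_real_derivative (N - 2) * t ^ (n + 1)) (at t)"
    "((\<lambda>t. t ^ (n + 1)) has_real_derivative (N - 3) * t ^ n) (at t)" for t
    using DERIV_pow[of "n + 4" t] DERIV_pow[of "n + 3" t] DERIV_pow[of "n + 2" t]
      DERIV_pow[of "n + 1" t]
    by (simp_all add: N_def algebra_simps)
  \<comment> \<open>The cubic interpolates \<open>W\<close> at both ends, and h - t^(n + 4) has the
    same end data by touching, so \<open>e\<close> has double zeros there. In the fourth derivative
    both the cubic and \<open>h\<close> disappear, leaving the drift minus \<kappa> times that of
    the sextic. \<open>W\<close> itself is never differentiated twice.\<close>
  define e where "e t = W l + v l * (t - l) + c2 * (t - l)^2 + c3 * (t - l)^3 - h t + t^(n + 4)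
    - \<kappa> * q (t - m)" for t
  define e1 where "e1 t = v l + 2 * c2 * (t - l) + 3 * c3 * (t - l)^2 - h1 t + N * t^(n + 3)
    - \<kappa> * q1 (t - m)" for t
  define e2 where "e2 t = 2 * c2 + 6 * c3 * (t - l) - f t + N * ((N - 1) * t^(n + 2))
    - \<kappa> * q2 (t - m)" for t
  define e3 where "e3 t = 6 * c3 - d + N * ((N - 1) * ((N - 2) * t^(n + 1)))
    - \<kappa> * q3 (t - m)" for t
  define e4 where "e4 t = N * ((N - 1) * ((N - 2) * ((N - 3) * t^n))) - \<kappa> * q4 (t - m)" for t
  have ex: "0 \<le> e x"
  proof (rule hermite_remainder_nonneg[of l x u e e1 e2 e3 e4])
    show "(e has_real_derivative e1 t) (at t)" for t
      unfolding e_def[abs_def] e1_def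
      by (rule derivative_eq_intros pw qs h | simp)+
    show "(e1 has_real_derivative e2 t) (at t)" for t
      unfolding e1_def[abs_def] e2_def
      by (rule derivative_eq_intros pw qs h1 | simp)+
    show "(e2 has_real_derivative e3 t) (at t)" if "t \<in> {l<..<u}" for t
      unfolding e2_def[abs_def] e3_def
      by (rule derivative_eq_intros pw qs f[OF that] | simp)+
    show "(e3 has_real_derivative e4 t) (at t)" for t
      unfolding e3_def[abs_def] e4_def
      by (rule derivative_eq_intros pw qs | simp)+
    show "0 \<le> e4 t" if "t \<in> {l<..<u}" for t
      using \<kappa>[of t] that unfolding e4_def q4 of_nat_mult N by (simp add: mult.assoc)
    show "e l = 0" "e u = 0"
      using lu p(1) unfolding e_def lm q0 touch_def by auto
    show "e1 l = 0" "e1 u = 0"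
      using lu(2,3)[THEN touch_deriv] p(2) unfolding e1_def lm q0 N by auto
  qed (use x in auto)
  have qx: "q (x - m) = ((x - m)^2 - r^2)^2 *
      ((x - m)^2 + 6 * m * (x - m) + 15 * (m^2 - 1) + 2 * r^2)"
  proof -
    have "q s = (s^2 - r^2)^2 * (s^2 + 6 * m * s + g)" for s
      unfolding q_def by (simp add: algebra_simps eval_nat_numeral)
    then show ?thesis by (simp add: g_def add.assoc)
  qed
  \<comment> \<open>Replacing W l by W x costs one more K (u - l), turning 11 into 12.\<close>
  have px: "W l + v l * (x - l) + c2 * (x - l)^2 + c3 * (x - l)^3 \<le> W x + 12 * K * (u - l)"
  proof -
    have "W l - W x \<le> K * (x - l)" using lip[of l x] x by auto
    also have "\<dots> \<le> K * (u - l)" using x K[of l] by (intro mult_left_mono) auto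
    finally show ?thesis using p(3)[of x] x by auto
  qed
  show ?thesis using ex px unfolding qx[symmetric] e_def by linarith
qed

lemma abs_le_in_bracket:
  assumes "bracket l u" "z \<in> {l..u}" "\<bar>z\<bar> \<le> 1" "t \<in> {l..u}"
  shows "\<bar>t\<bar> \<le> u - l + 1" "\<bar>v t\<bar> \<le> R * (2 + (u - l))"
proof -
  show t: "\<bar>t\<bar> \<le> u - l + 1" using assms by auto
  then have "R * (1 + \<bar>t\<bar>) \<le> R * (2 + (u - l))"
    using R by (intro mult_left_mono) auto
  then show "\<bar>v t\<bar> \<le> R * (2 + (u - l))" using growth[of t] by linarith
qed

text \<open>At the midpoint the sextic is at least r^6 for large r, so after multiplication by
  \<kappa> of order 1 / r^2 the drift forces a term of order r^4, while the path allows only order R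
  r^2.\<close>

lemma bracket_length:
  assumes br: "bracket l u" and z: "z \<in> {l..u}" "\<bar>z\<bar> \<le> 1"
  shows "(u - l)^2 \<le> 51840 * R"
proof (rule ccontr)
  assume long: "\<not> (u - l)^2 \<le> 51840 * R"
  define r where "r = (u - l) / 2"
  define m where "m = (l + u) / 2"
  have ul: "u - l = 2 * r" "l < u" using br by (auto simp: r_def bracket_def)
  have r2: "12960 * R < r^2" using long unfolding ul by (simp add: power_mult_distrib)
  then have "15 \<le> r^2" using R by linarith
  have r: "1 \<le> r"
    using \<open>15 \<le> r^2\<close> ul by (smt (verit) power_le_one)
  \<comment> \<open>Points of the interval satisfy |t| \<le> 2 r + 1, so this \<kappa> keeps
    \<kappa> * 360 (t^2 - 1) at most 24 = 4 * 3 * 2 * 1, the smallest coefficient of t^n, attained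
    at n = 0.\<close>
  define \<kappa> where "\<kappa> = 1 / (15 * (2 * r + 1)^2)"
  have \<kappa>_ge: "1 / (135 * r^2) \<le> \<kappa>"
  proof -
    have "(2 * r + 1)^2 \<le> (3 * r)^2" using r by (intro power_mono) auto
    then show ?thesis unfolding \<kappa>_def using r
      by (intro divide_left_mono) (auto simp: power_mult_distrib intro!: mult_pos_pos)
  qed
  have "\<kappa> * (360 * (t^2 - 1)) \<le> real ((n + 4) * (n + 3) * (n + 2) * (n + 1)) * t ^ n"
    if t: "t \<in> {l..u}" for t
  proof -
    have pos: "0 \<le> real ((n + 4) * (n + 3) * (n + 2) * (n + 1)) * t ^ n"
      using even by (simp add: zero_le_power_eq)
    show ?thesis
    proof (cases "\<bar>t\<bar> \<le> 1")
      case True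
      then have "t^2 \<le> 1" by (simp add: abs_square_le_1)
      then have "\<kappa> * (360 * (t^2 - 1)) \<le> 0"
        by (intro mult_nonneg_nonpos) (auto simp: \<kappa>_def)
      then show ?thesis using pos by linarith
    next
      case False
      have "\<bar>t\<bar> \<le> \<bar>2 * r + 1\<bar>" using abs_le_in_bracket(1)[OF br z t] ul r by auto
      then have "t^2 \<le> (2 * r + 1)^2" by (simp only: abs_le_square_iff)
      then have "t^2 - 1 \<le> (2 * r + 1)^2" by linarith
      then have "\<kappa> * (360 * (t^2 - 1)) \<le> \<kappa> * (360 * (2 * r + 1)^2)"
        by (intro mult_left_mono) (auto simp: \<kappa>_def)
      also have "\<dots> = 24" using r by (simp add: \<kappa>_def)
      also have "\<dots> \<le> real ((n + 4) * (n + 3) * (n + 2) * (n + 1)) * 1"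
      proof -
        have "4 * 3 * 2 * 1 \<le> (n + 4) * (n + 3) * (n + 2) * (n + 1)"
          by (intro mult_le_mono) auto
        then show ?thesis by linarith
      qed
      also have "\<dots> \<le> real ((n + 4) * (n + 3) * (n + 2) * (n + 1)) * t ^ n"
      proof (intro mult_left_mono)
        have "1 \<le> \<bar>t\<bar> ^ n" using False by (intro one_le_power) auto
        then show "1 \<le> t ^ n" using even by (simp add: power_even_abs)
      qed auto
      finally show ?thesis .
    qed
  qed
  then have "h m - (W m + m ^ (n + 4)) + \<kappa> * ((r^2)^2 * (15 * (m^2 - 1) + 2 * r^2))
      \<le> 12 * (R * (2 + (u - l))) * (u - l)"
    using bracket_estimate[OF br, of m "R * (2 + (u - l))" \<kappa>] abs_le_in_bracket(2)[OF br z] ul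
    by (simp add: m_def[symmetric] r_def[symmetric]) (simp add: m_def)
  then have *: "\<kappa> * ((r^2)^2 * (15 * (m^2 - 1) + 2 * r^2)) \<le> 12 * (R * (2 + 2 * r)) * (2 * r)"
    using above[of m] unfolding ul by linarith
  have "r^2 * r^2 / 135 = 1 / (135 * r^2) * ((r^2)^2 * r^2)"
    using r by (simp add: power2_eq_square)
  also have "\<dots> \<le> \<kappa> * ((r^2)^2 * r^2)"
    by (intro mult_right_mono \<kappa>_ge) auto
  also have "\<dots> \<le> \<kappa> * ((r^2)^2 * (15 * (m^2 - 1) + 2 * r^2))"
  proof (intro mult_left_mono)
    show "r^2 \<le> 15 * (m^2 - 1) + 2 * r^2"
    proof -
      have "15 * (m^2 - 1) = 15 * m^2 - 15" "0 \<le> 15 * m^2" by simp_all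
      then show ?thesis using \<open>15 \<le> r^2\<close> by linarith
    qed
  qed (auto simp: \<kappa>_def)
  also note *
  also have "12 * (R * (2 + 2 * r)) * (2 * r) \<le> 12 * (R * (4 * r)) * (2 * r)"
    using r R by (intro mult_right_mono mult_left_mono) auto
  also have "\<dots> = 96 * R * r^2" by (simp add: power2_eq_square)
  \<comment> \<open>12960 = 135 * 96; the bound on (u - l)^2 = 4 r^2 is four times as large.\<close>
  finally have "r^2 * r^2 \<le> (12960 * R) * r^2" by linarith
  then have "r^2 \<le> 12960 * R" by (rule mult_right_le_imp_le) (use r in simp)
  then show False using r2 by simp
qed

text \<open>Were (0, x] touch-free, the touch-free interval around x would reach back to some l
  \<le> 0. It then contains 0, so the length bound applies, although its length exceeds x. The
  surplus in 51841 gives x^2 \<ge> x > 51840 R.\<close>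

lemma touch_soon: "\<exists>t. 0 < t \<and> t \<le> 51841 * R \<and> touch t"
proof (rule ccontr)
  define x where "x = 51841 * R"
  assume "\<nexists>t. 0 < t \<and> t \<le> 51841 * R \<and> touch t"
  then have no: "\<not> touch t" if "0 < t" "t \<le> x" for t using that by (auto simp: x_def)
  have x: "0 < x" "1 \<le> x" "51840 * R < x" using R by (auto simp: x_def)
  obtain l u where lu: "bracket l u" "l < x" "x < u"
    using bracket_exists[OF no[of x]] x by auto
  have "l \<le> 0" using no[of l] lu by (force simp: bracket_def)
  then have "(u - l)^2 \<le> 51840 * R" using bracket_length[OF lu(1), of 0] lu x by auto
  moreover have "x * 1 \<le> x * x" using x by (intro mult_left_mono) auto
  moreover have "x * x \<le> (u - l) * (u - l)" using lu x \<open>l \<le> 0\<close> by (intro mult_mono) auto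
  ultimately show False using x(3) by (simp add: power2_eq_square)
qed

section \<open>Bounds for the second and third derivatives at 0\<close>

lemma h_bound:
  assumes x: "\<bar>x\<bar> \<le> 1 / 2"
  shows "\<bar>h x\<bar> \<le> 1300000 * R^2"
proof -
  have R2: "R \<le> R^2" "1 \<le> R^2" using R self_le_power[of R 2] one_le_power[of R 2] by auto
  have "\<bar>x ^ (n + 4)\<bar> \<le> 1" using x by (simp add: power_abs power_le_one)
  moreover have "\<bar>W x\<bar> \<le> R"
  proof -
    have "R * (1 + \<bar>x\<bar>) * \<bar>x\<bar> \<le> R * 2 * (1 / 2)"
      using x R by (intro mult_mono) auto
    then show ?thesis using W_bound[of x] by simp
  qed
  moreover have "\<bar>h x - (W x + x ^ (n + 4))\<bar> \<le> 1244172 * R^2"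
  proof (cases "touch x")
    case False
    then obtain l u where lu: "bracket l u" "l < x" "x < u" using bracket_exists by blast
    have z: "x \<in> {l..u}" "\<bar>x\<bar> \<le> 1" using lu x by auto
    \<comment> \<open>Taking \<kappa> = 0 discards the sextic; the condition on \<kappa> is then
      just t^n \<ge> 0. Below, 103681 = 2 * 51840 + 1.\<close>
    have "h x - (W x + x ^ (n + 4)) \<le> 12 * (R * (2 + (u - l))) * (u - l)"
      using bracket_estimate[OF lu, of "R * (2 + (u - l))" 0] abs_le_in_bracket(2)[OF lu(1) z] even
      by (simp add: zero_le_power_eq)
    also have "\<dots> = 12 * R * (2 * (u - l) + (u - l)^2)"
      by (simp add: power2_eq_square algebra_simps)
    also have "\<dots> \<le> 12 * R * (103681 * R)"
    proof (intro mult_left_mono)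
      have "0 \<le> (u - l - 1)^2" by simp
      then have "2 * (u - l) \<le> 1 + (u - l)^2" by (simp add: power2_eq_square algebra_simps)
      then show "2 * (u - l) + (u - l)^2 \<le> 103681 * R"
        using bracket_length[OF lu(1) z] R by linarith
    qed (use R in auto)
    finally show ?thesis using above[of x] by (simp add: power2_eq_square)
  qed (auto simp: touch_def)
  ultimately show ?thesis using R2 by linarith
qed

text \<open>By midpoint convexity, f (x + s) + f (x - s) \<ge> 2 f x. Integrating twice, the second
  difference of h with step 1/4 is at least f x / 16, and it is at most 4 H.\<close>

lemma f_upper:
  assumes x: "\<bar>x\<bar> \<le> 1 / 4" and H: "\<And>t. \<bar>t\<bar> \<le> 1 / 2 \<Longrightarrow> \<bar>h t\<bar> \<le> H"
  shows "f x \<le> 64 * H"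
proof -
  define p where "p s = f x * s^2 - h (x + s) - h (x - s)" for s
  define p1 where "p1 s = 2 * f x * s - h1 (x + s) + h1 (x - s)" for s
  have d: "((\<lambda>s. x + s) has_real_derivative 1) (at s)"
    "((\<lambda>s. x - s) has_real_derivative - 1) (at s)" for s
    by (auto intro!: derivative_eq_intros)
  have "p (1/4) \<le> p 0 + p1 0 * (1 / 4 - 0)"
  proof (rule concave_below_tangent[of 0 "1 / 4" p p1 "\<lambda>s. 2 * f x - f (x + s) - f (x - s)"])
    show "(p has_real_derivative p1 s) (at s)" for s
      unfolding p_def[abs_def] p1_def
      by (auto intro!: derivative_eq_intros DERIV_chain2[OF h d(1)] DERIV_chain2[OF h d(2)])
    show "(p1 has_real_derivative 2 * f x - f (x + s) - f (x - s)) (at s)" for s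
      unfolding p1_def[abs_def]
      by (auto intro!: derivative_eq_intros DERIV_chain2[OF h1 d(1)] DERIV_chain2[OF h1 d(2)])
    show "2 * f x - f (x + s) - f (x - s) \<le> 0" for s
    proof -
      have "(1 - 1 / 2) *\<^sub>R (x + s) + (1 / 2) *\<^sub>R (x - s) = x" by (simp add: field_simps)
      then have "f x \<le> (1 - 1 / 2) * f (x + s) + 1 / 2 * f (x - s)"
        using convex_onD[OF convex, of "1 / 2" "x + s" "x - s"] by fastforce
      then show ?thesis by simp
    qed
  qed auto
  then have "f x / 16 \<le> h (x + 1 / 4) + h (x - 1 / 4) - 2 * h x"
    by (simp add: p_def p1_def power2_eq_square)
  also have "\<dots> \<le> 4 * H"
  proof -
    have "\<bar>x + 1 / 4\<bar> \<le> 1 / 2" "\<bar>x - 1 / 4\<bar> \<le> 1 / 2" "\<bar>x\<bar> \<le> 1 / 2" using x by linarith+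
    then show ?thesis using H[of "x + 1 / 4"] H[of "x - 1 / 4"] H[of x] by linarith
  qed
  finally show ?thesis by simp
qed

text \<open>A convex function bounded above by U at distance 1/4 on both sides lies below its chords
  from 0, so a very negative \<open>f 0\<close> drags \<open>f\<close> down nearby. Integrating the
  chord bound twice gives the cubic subtracted in \<open>p\<close>, and the second difference of h,
  at least - 4 H, limits the drop.\<close>

lemma f_lower:
  assumes H: "\<And>t. \<bar>t\<bar> \<le> 1 / 2 \<Longrightarrow> \<bar>h t\<bar> \<le> H"
  shows "- 128 * H \<le> f 0"
proof -
  define U where "U = 64 * H"
  define p where "p s = h s + h (- s) - f 0 * s^2 - (U - f 0) * (4 / 3 * s^3)" for s
  define p1 where "p1 s = h1 s - h1 (- s) - 2 * f 0 * s - (U - f 0) * (4 * s^2)" for s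
  have d: "(uminus has_real_derivative - 1) (at s)" for s :: real
    by (auto intro!: derivative_eq_intros)
  have chord: "f (\<sigma> * s) \<le> f 0 + 4 * s * (U - f 0)"
    if s: "0 \<le> s" "s \<le> 1 / 4" and \<sigma>: "\<bar>\<sigma>\<bar> = 1" for s \<sigma>
  proof -
    have "f (\<sigma> * s) \<le> (1 - 4 * s) * f 0 + 4 * s * f (\<sigma> / 4)"
      using convex_onD[OF convex, of "4 * s" 0 "\<sigma> / 4"] s by (simp add: mult.commute)
    also have "\<dots> \<le> (1 - 4 * s) * f 0 + 4 * s * U"
    proof (intro add_left_mono mult_left_mono)
      show "f (\<sigma> / 4) \<le> U" unfolding U_def by (rule f_upper[OF _ H]) (use \<sigma> in auto)
    qed (use s in auto)
    finally show ?thesis by (simp add: algebra_simps)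
  qed
  have "p (1/4) \<le> p 0 + p1 0 * (1 / 4 - 0)"
  proof (rule concave_below_tangent[of 0 "1 / 4" p p1
        "\<lambda>s. f s + f (- s) - 2 * f 0 - (U - f 0) * (8 * s)"])
    show "(p has_real_derivative p1 s) (at s)" for s
      unfolding p_def[abs_def] p1_def
      by (auto intro!: derivative_eq_intros h DERIV_chain2[OF h d])
    show "(p1 has_real_derivative f s + f (- s) - 2 * f 0 - (U - f 0) * (8 * s)) (at s)" for s
      unfolding p1_def[abs_def]
      by (auto intro!: derivative_eq_intros h1 DERIV_chain2[OF h1 d])
    show "f s + f (- s) - 2 * f 0 - (U - f 0) * (8 * s) \<le> 0" if "s \<in> {0..1 / 4}" for s
      using chord[of s 1] chord[of s "- 1"] that by (auto simp: algebra_simps)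
  qed auto
  then have "h (1 / 4) + h (- 1 / 4) - 2 * h 0 \<le> f 0 / 24 + U / 48"
    by (simp add: p_def p1_def field_simps eval_nat_numeral)
  moreover have "- 4 * H \<le> h (1 / 4) + h (- 1 / 4) - 2 * h 0"
    using H[of "1 / 4"] H[of "- 1 / 4"] H[of 0] by (auto simp: abs_le_iff)
  ultimately show ?thesis unfolding U_def by linarith
qed

text \<open>Slopes over [-1/4, 0] and [0, 1/4] trap the right derivative: 4 (64 + 128) = 768, and
  768 * 1300000 is just below 10^9.\<close>

lemma curvature_bounds:
  shows "\<bar>f 0\<bar> \<le> 10^9 * R^2" and "\<bar>rderiv f 0\<bar> \<le> 10^9 * R^2"
proof -
  define H where "H = 1300000 * R^2"
  have "\<bar>h t\<bar> \<le> H" if "\<bar>t\<bar> \<le> 1 / 2" for t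
    using h_bound[OF that] by (simp add: H_def)
  then have b: "- 128 * H \<le> f 0" "f 0 \<le> 64 * H" "f (1 / 4) \<le> 64 * H" "f (- 1 / 4) \<le> 64 * H"
    using f_lower[of H] f_upper[of _ H] by auto
  have H: "0 \<le> H" "768 * H \<le> 10^9 * R^2" by (simp_all add: H_def)
  show "\<bar>f 0\<bar> \<le> 10^9 * R^2" using b H by (simp add: abs_le_iff)
  have "rderiv f 0 \<le> 4 * (f (1 / 4) - f 0)" "4 * (f 0 - f (- 1 / 4)) \<le> rderiv f 0"
    using convex_rderiv_le_slope[OF convex, of 0 "1 / 4"]
      convex_slope_le_rderiv[OF convex, of "- 1 / 4" 0] by simp_all
  then show "\<bar>rderiv f 0\<bar> \<le> 10^9 * R^2" using b H by (simp add: abs_le_iff)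
qed

end

section \<open>From the integral condition to the pathwise bounds\<close>

lemma deriv3_constant_off_touch:
  assumes inv: "invelope Y h" and Y: "continuous_on UNIV Y"
    and S: "is_interval S" "\<And>s. s \<in> S \<Longrightarrow> h s \<noteq> Y s"
  shows "\<exists>c d. \<forall>s\<in>S. deriv2 h s = c + d * s"
proof (cases "S = {}")
  case False
  then obtain s0 where s0: "s0 \<in> S" by blast
  have convex: "convex_on UNIV (deriv2 h)" and ge: "\<And>t. Y t \<le> h t"
    and int0: "(\<integral>\<^sup>+ t. ennreal (h t - Y t) \<partial>(interval_measure (deriv3 h))) = 0"
    and hd: "\<And>t. h differentiable (at t)"
    using inv by (auto simp: invelope_def)
  define F where "F = rderiv (deriv2 h)"
  define \<mu> where "\<mu> = interval_measure F"
  have F: "deriv3 h = F" by (simp add: F_def deriv3_def)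
  have mono: "F x \<le> F y" if "x \<le> y" for x y
    unfolding F_def by (rule convex_rderiv_mono[OF convex that])
  have rc: "continuous (at_right a) F" for a
    unfolding F_def by (rule convex_rderiv_right_continuous[OF convex])
  have "continuous_on UNIV h"
    using hd by (simp add: continuous_on_eq_continuous_at differentiable_imp_continuous_within)
  then have meas: "(\<lambda>t. h t - Y t) \<in> borel_measurable \<mu>"
    using Y by (simp add: \<mu>_def borel_measurable_continuous_onI continuous_on_diff
        cong: measurable_cong_sets)
  then have "AE t in \<mu>. ennreal (h t - Y t) = 0"
    using int0 unfolding F \<mu>_def by (subst (asm) nn_integral_0_iff_AE) auto
  \<comment> \<open>\<open>ennreal\<close> truncates negative values, so the zero only says h \<le>
    Y; equality uses h \<ge> Y. Hence the measure of the third derivative charges no touch-free (s,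
    t].\<close>
  then have AE: "AE t in \<mu>. h t = Y t"
    by eventually_elim (use ge in \<open>auto simp: ennreal_eq_0_iff intro: antisym\<close>)
  have const_le: "F t \<le> F s" if st: "s \<in> S" "t \<in> S" "s \<le> t" for s t
  proof -
    have sub: "{s..t} \<subseteq> S"
      using mem_is_interval_1_I[OF S(1) st(1,2)] by auto
    have "h u \<noteq> Y u" if "u \<in> {s<..t}" for u
      by (rule S(2)) (use sub that in auto)
    then have null: "AE u in \<mu>. u \<notin> {s<..t}"
      by (intro eventually_mono[OF AE]) blast
    have "(AE u in \<mu>. u \<notin> {s<..t}) \<longleftrightarrow> emeasure \<mu> {s<..t} = 0"
      by (rule AE_iff_measurable) (auto simp: \<mu>_def)
    then have "emeasure \<mu> {s<..t} = 0" using null by (simp only:)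
    then have "ennreal (F t - F s) = 0"
      using emeasure_interval_measure_Ioc[of s t F, OF st(3) mono rc] unfolding \<mu>_def by simp
    then show ?thesis by (simp add: ennreal_eq_0_iff)
  qed
  have const: "F s = F s0" if "s \<in> S" for s
  proof (cases "s \<le> s0")
    case True
    show ?thesis by (rule antisym[OF mono[OF True] const_le[OF that s0 True]])
  next
    case False
    then have le: "s0 \<le> s" by simp
    show ?thesis by (rule antisym[OF const_le[OF s0 that le] mono[OF le]])
  qed
  have slope: "deriv2 h t - deriv2 h s = F s0 * (t - s)" if st: "s \<in> S" "t \<in> S" "s < t" for s t
  proof -
    \<comment> \<open>The slope lies between the right derivatives at s and t, which
      coincide.\<close>
    have "(deriv2 h t - deriv2 h s) / (t - s) = F s0"
      using convex_rderiv_le_slope[OF convex st(3)] convex_slope_le_rderiv[OF convex st(3)]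
        const[OF st(1)] const[OF st(2)] unfolding F_def by linarith
    then show ?thesis using st by (simp add: field_simps)
  qed
  have "\<forall>s\<in>S. deriv2 h s = (deriv2 h s0 - F s0 * s0) + F s0 * s"
  proof
    fix s assume "s \<in> S"
    then show "deriv2 h s = (deriv2 h s0 - F s0 * s0) + F s0 * s"
      using slope[of s s0] slope[of s0 s] s0
      by (cases s s0 rule: linorder_cases) (auto simp: algebra_simps)
  qed
  then show ?thesis by blast
qed auto

lemma interval_integral_has_real_derivative:
  fixes b :: "real \<Rightarrow> real"
  assumes "continuous_on UNIV b"
  shows "((\<lambda>t. LBINT s=0..t. b s) has_real_derivative b t) (at t)"
proof -
  \<comment> \<open>The interval has both 0 and t in its interior, so the one-sided restriction of
    the derivative can be removed.\<close>
  have "((\<lambda>u. LBINT y=0..u. b y) has_vector_derivative b t) (at t within {- \<bar>t\<bar> - 1..\<bar>t\<bar> + 1})"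
    using interval_integral_FTC2[of "- \<bar>t\<bar> - 1" 0 "\<bar>t\<bar> + 1" b t] assms
    by (simp add: zero_ereal_def continuous_on_subset)
  moreover have "at t within {- \<bar>t\<bar> - 1..\<bar>t\<bar> + 1} = at t"
    by (rule at_within_interior) (auto simp: interior_atLeastAtMost_real)
  ultimately show ?thesis
    by (simp add: has_real_derivative_iff_has_vector_derivative)
qed

lemma invelope_controlled:
  assumes "even n" "1 \<le> R" and b: "continuous_on UNIV b"
    and growth: "\<And>t. \<bar>b t\<bar> \<le> R * (1 + \<bar>t\<bar>)"
    and inv: "invelope (Yproc (n + 2) b) h"
  shows "controlled_invelope n R b (\<lambda>t. LBINT s=0..t. b s) h (deriv h) (deriv2 h)"
proof
  have Y: "Yproc (n + 2) b t = (LBINT s=0..t. b s) + t ^ (n + 4)" for t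
    by (simp add: Yproc_def numeral_eq_Suc)
  show "((\<lambda>t. LBINT s=0..t. b s) has_real_derivative b t) (at t)" for t
    by (rule interval_integral_has_real_derivative[OF b])
  then have "continuous_on UNIV (\<lambda>t::real. LBINT s=0..t. b s)"
    by (meson DERIV_continuous_on has_field_derivative_at_within)
  then have contY: "continuous_on UNIV (Yproc (n + 2) b)"
    unfolding Y[abs_def] by (intro continuous_intros)
  show "(h has_real_derivative deriv h t) (at t)" for t
    using inv by (simp add: invelope_def DERIV_deriv_iff_real_differentiable)
  show "(deriv h has_real_derivative deriv2 h t) (at t)" for t
    using inv by (simp add: invelope_def deriv2_def DERIV_deriv_iff_real_differentiable)
  show "convex_on UNIV (deriv2 h)" using inv by (simp add: invelope_def)
  show "(LBINT s=0..t. b s) + t ^ (n + 4) \<le> h t" for t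
    using inv unfolding invelope_def Y by blast
  show "\<exists>c d. \<forall>s\<in>S. deriv2 h s = c + d * s"
    if "is_interval S" "\<And>s. s \<in> S \<Longrightarrow> h s \<noteq> (LBINT x=0..s. b x) + s ^ (n + 4)" for S
    using deriv3_constant_off_touch[OF inv contY that(1)] that(2) Y by simp
qed (use assms in \<open>auto simp: zero_ereal_def[symmetric]\<close>)

lemma invelope_bounds:
  assumes "even n" "1 \<le> R" and b: "continuous_on UNIV b"
    and growth: "\<And>t. \<bar>b t\<bar> \<le> R * (1 + \<bar>t\<bar>)"
    and inv: "invelope (Yproc (n + 2) b) h"
  shows "\<bar>deriv2 h 0\<bar> \<le> 10^9 * R^2" "\<bar>deriv3 h 0\<bar> \<le> 10^9 * R^2"
    "hminus (Yproc (n + 2) b) h \<le> 10^9 * R^2" "hplus (Yproc (n + 2) b) h \<le> 10^9 * R^2"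
proof -
  interpret controlled_invelope n R b "\<lambda>t. LBINT s=0..t. b s" h "deriv h" "deriv2 h"
    by (rule invelope_controlled[OF assms])
  show "\<bar>deriv2 h 0\<bar> \<le> 10^9 * R^2" "\<bar>deriv3 h 0\<bar> \<le> 10^9 * R^2"
    using curvature_bounds by (simp_all add: deriv3_def)
  have touch_Y: "h t = Yproc (n + 2) b t" if "touch t" for t
    using that by (simp add: touch_def Yproc_def numeral_eq_Suc)
  have Inf_le: "Inf {s. 0 < s \<and> P s} \<le> 10^9 * R^2"
    if s: "0 < s" "s \<le> 51841 * R" "P s" for P and s :: real
  proof -
    have "Inf {s. 0 < s \<and> P s} \<le> s" using s by (intro cInf_lower) (auto intro!: bdd_belowI[of _ 0])
    also have "\<dots> \<le> 10^9 * R^2" using s(2) self_le_power[of R 2] \<open>1 \<le> R\<close> by simp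
    finally show ?thesis .
  qed
  obtain s where "0 < s" "s \<le> 51841 * R" "touch s" using touch_soon by blast
  then show "hplus (Yproc (n + 2) b) h \<le> 10^9 * R^2"
    unfolding hplus_def by (intro Inf_le[of s] touch_Y) auto
  obtain s where "0 < s" "s \<le> 51841 * R" "touch (- s)"
    using controlled_invelope.touch_soon[OF reflect] unfolding touch_reflect by blast
  then show "hminus (Yproc (n + 2) b) h \<le> 10^9 * R^2"
    unfolding hminus_def by (intro Inf_le[of s] touch_Y) auto
qed

section \<open>Growth of Brownian paths\<close>

text \<open>Chernoff bound with the optimal parameter s = x / \<sigma>^2. Exponential tilting turns
  the centred density into a constant times the density with mean x, so the moment generating
  function comes from total mass 1.\<close>

lemma normal_tail:
  fixes X :: "'a \<Rightarrow> real"
  assumes M: "prob_space M" and \<sigma>: "0 < \<sigma>" and x: "0 < x"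
    and X: "distributed M lborel X (\<lambda>y. ennreal (normal_density 0 \<sigma> y))"
  shows "measure M {\<omega> \<in> space M. x \<le> X \<omega>} \<le> exp (- (x^2) / (2 * \<sigma>^2))"
proof -
  interpret prob_space M by fact
  define s where "s = x / \<sigma>^2"
  have s: "0 < s" using x \<sigma> by (simp add: s_def)
  have tilt: "normal_density 0 \<sigma> y * exp (s * y) = exp (s^2 * \<sigma>^2 / 2) * normal_density x \<sigma> y" for y
  proof -
    have "- (y^2 / (2 * \<sigma>^2)) + s * y = s^2 * \<sigma>^2 / 2 + - ((y - x)^2 / (2 * \<sigma>^2))"
      using \<sigma> by (simp add: s_def field_simps power2_eq_square)
    then show ?thesis
      by (simp add: normal_density_def exp_add[symmetric] mult.commute)
  qed
  have int: "integrable lborel (\<lambda>y. normal_density 0 \<sigma> y * exp (s * y))"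
    unfolding tilt using \<sigma> by simp
  have "integrable M (\<lambda>\<omega>. exp (s * X \<omega>))"
    using int distributed_integrable[OF X, of "\<lambda>y. exp (s * y)"] by simp
  then have "measure M {\<omega> \<in> space M. x \<le> X \<omega>} \<le>
      exp (- s * x) * (\<integral>\<omega>\<in>space M. exp (s * X \<omega>) \<partial>M)"
    by (intro Chernoff_ineq_ge s) (auto simp: set_integrable_def simp flip: mult.assoc
        cong: Bochner_Integration.integrable_cong)
  also have "(\<integral>\<omega>\<in>space M. exp (s * X \<omega>) \<partial>M) = (\<integral>\<omega>. exp (s * X \<omega>) \<partial>M)"
    by (rule set_integral_space) fact
  also have "\<dots> = (\<integral>y. normal_density 0 \<sigma> y * exp (s * y) \<partial>lborel)"
    using distributed_integral[OF X, of "\<lambda>y. exp (s * y)"] by simp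
  also have "\<dots> = exp (s^2 * \<sigma>^2 / 2)"
    unfolding tilt using \<sigma> by simp
  also have "exp (- s * x) * exp (s^2 * \<sigma>^2 / 2) = exp (- (x^2) / (2 * \<sigma>^2))"
    unfolding exp_add[symmetric] using \<sigma> by (simp add: s_def field_simps power2_eq_square)
  finally show ?thesis .
qed

lemma normal_tail_abs:
  fixes X :: "'a \<Rightarrow> real"
  assumes M: "prob_space M" and \<sigma>: "0 < \<sigma>" and x: "0 < x"
    and X: "distributed M lborel X (\<lambda>y. ennreal (normal_density 0 \<sigma> y))"
  shows "measure M {\<omega> \<in> space M. x \<le> \<bar>X \<omega>\<bar>} \<le> 2 * exp (- (x^2) / (2 * \<sigma>^2))"
proof -
  interpret prob_space M by fact
  have [measurable]: "X \<in> borel_measurable M"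
    using distributed_measurable[OF X] by simp
  have "distributed M lborel (\<lambda>\<omega>. 0 + (-1) * X \<omega>) (\<lambda>y. ennreal (normal_density (0 + (-1) * 0) (\<bar>-1\<bar> * \<sigma>) y))"
    by (rule normal_density_affine[OF X \<sigma>]) simp
  then have X': "distributed M lborel (\<lambda>\<omega>. - X \<omega>) (\<lambda>y. ennreal (normal_density 0 \<sigma> y))"
    by simp
  have "{\<omega> \<in> space M. x \<le> \<bar>X \<omega>\<bar>} = {\<omega> \<in> space M. x \<le> X \<omega>} \<union> {\<omega> \<in> space M. x \<le> - X \<omega>}"
    by auto
  then have "measure M {\<omega> \<in> space M. x \<le> \<bar>X \<omega>\<bar>} \<le>
      measure M {\<omega> \<in> space M. x \<le> X \<omega>} + measure M {\<omega> \<in> space M. x \<le> - X \<omega>}"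
    by (simp add: measure_Un_le)
  also have "\<dots> \<le> 2 * exp (- (x^2) / (2 * \<sigma>^2))"
    using normal_tail[OF M \<sigma> x X] normal_tail[OF M \<sigma> x X'] by simp
  finally show ?thesis .
qed

section \<open>Dyadic chaining\<close>

lemma dyadic_chaining:
  fixes b :: "real \<Rightarrow> real"
  assumes b0: "b 0 = 0" and D: "0 \<le> D"
    and incr: "\<And>n k. k < 2^n \<Longrightarrow> \<bar>b (real (Suc k) / 2^n) - b (real k / 2^n)\<bar> \<le> D * (3/4)^n"
    and k: "k \<le> 2^n"
  shows "\<bar>b (real k / 2^n)\<bar> \<le> 4 * D"
proof -
  have "\<bar>b (real k / 2^n)\<bar> \<le> D * (\<Sum>i\<le>n. (3/4)^i)" if "k \<le> 2^n" for k
    using that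
  proof (induction n arbitrary: k)
    case 0
    then have "k = 0 \<or> k = 1" by auto
    then show ?case using incr[of 0 0] b0 D by auto
  next
    case (Suc n)
    have half: "real (2 * j) / 2 ^ Suc n = real j / 2^n" for j by simp
    \<comment> \<open>A dyadic point of the next level is an old one (k even) or the right neighbour
      of an old one (k odd), so each level adds at most one increment. The geometric sum stays below
      4.\<close>
    show ?case
    proof (cases "even k")
      case True
      then obtain j where j: "k = 2 * j" by blast
      then have "\<bar>b (real k / 2 ^ Suc n)\<bar> \<le> D * (\<Sum>i\<le>n. (3/4)^i)"
        using Suc.IH[of j] Suc.prems half[of j] by simp
      also have "\<dots> \<le> D * (\<Sum>i\<le>Suc n. (3/4)^i)" using D by (intro mult_left_mono) auto
      finally show ?thesis .
    next
      case False
      then obtain j where j: "k = Suc (2 * j)" by (auto elim: oddE)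
      have "\<bar>b (real k / 2 ^ Suc n) - b (real j / 2^n)\<bar> \<le> D * (3/4) ^ Suc n"
        using incr[of "2 * j" "Suc n"] j Suc.prems half[of j] by simp
      moreover have "\<bar>b (real j / 2^n)\<bar> \<le> D * (\<Sum>i\<le>n. (3/4)^i)"
        using Suc.IH[of j] Suc.prems j by simp
      ultimately have "\<bar>b (real k / 2 ^ Suc n)\<bar> \<le> D * (\<Sum>i\<le>n. (3/4)^i) + D * (3/4) ^ Suc n"
        by linarith
      then show ?thesis by (simp only: sum.atMost_Suc distrib_left)
    qed
  qed
  then have "\<bar>b (real k / 2^n)\<bar> \<le> D * (\<Sum>i\<le>n. (3/4)^i)" using k .
  also have "(\<Sum>i\<le>n. (3/4 :: real)^i) = 4 - 3 * (3/4)^n"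
    by (induction n) auto
  also have "D * \<dots> \<le> D * 4" using D by (intro mult_left_mono) auto
  finally show ?thesis by simp
qed

lemma dyadic_sup_bound:
  fixes b :: "real \<Rightarrow> real"
  assumes cont: "continuous_on {0..1} b" and b0: "b 0 = 0" and D: "0 \<le> D"
    and incr: "\<And>n k. k < 2^n \<Longrightarrow> \<bar>b (real (Suc k) / 2^n) - b (real k / 2^n)\<bar> \<le> D * (3/4)^n"
    and t: "t \<in> {0..1}"
  shows "\<bar>b t\<bar> \<le> 4 * D"
proof -
  define k where "k n = nat \<lfloor>t * 2^n\<rfloor>" for n :: nat
  have k: "real (k n) = of_int \<lfloor>t * 2^n\<rfloor>" for n
    using t by (simp add: k_def)
  have "real (k n) \<le> 2^n" for n
  proof -
    have "t * 2^n \<le> 1 * 2^n" using t by (intro mult_right_mono) auto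
    then show ?thesis unfolding k by linarith
  qed
  then have kle: "k n \<le> 2^n" for n by (metis of_nat_le_iff of_nat_numeral of_nat_power)
  have near: "t - (1/2)^n \<le> real (k n) / 2^n" "real (k n) / 2^n \<le> t" for n
  proof -
    have "t * 2^n - 1 \<le> real (k n)" "real (k n) \<le> t * 2^n" unfolding k by linarith+
    then have "(t * 2^n - 1) / 2^n \<le> real (k n) / 2^n" "real (k n) / 2^n \<le> t * 2^n / 2^n"
      by (simp_all only: divide_right_mono zero_le_power zero_le_numeral)
    then show "t - (1/2)^n \<le> real (k n) / 2^n" "real (k n) / 2^n \<le> t"
      by (simp_all add: diff_divide_distrib power_one_over)
  qed
  have "(\<lambda>n. real (k n) / 2^n) \<longlonglongrightarrow> t"
  proof (rule tendsto_sandwich[OF _ _ _ tendsto_const])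
    have "(\<lambda>n. t - (1/2)^n) \<longlonglongrightarrow> t - 0"
      by (intro tendsto_intros LIMSEQ_realpow_zero) auto
    then show "(\<lambda>n. t - (1/2)^n) \<longlonglongrightarrow> t" by simp
  qed (use near in auto)
  moreover have "real (k n) / 2^n \<in> {0..1}" for n
    using \<open>real (k n) \<le> 2^n\<close> by (simp add: field_simps)
  ultimately have "(\<lambda>n. b (real (k n) / 2^n)) \<longlonglongrightarrow> b t"
    using cont t unfolding continuous_on_sequentially by (auto simp: comp_def)
  then have "(\<lambda>n. \<bar>b (real (k n) / 2^n)\<bar>) \<longlonglongrightarrow> \<bar>b t\<bar>" by (rule tendsto_rabs)
  moreover have "\<bar>b (real (k n) / 2^n)\<bar> \<le> 4 * D" for n
    using dyadic_chaining[OF b0 D incr kle] .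
  ultimately show ?thesis by (intro LIMSEQ_le_const2) auto
qed

lemma two_sided_BM_increment_tail:
  assumes BM: "two_sided_BM M B" and st: "s < t" and x: "0 < x"
  shows "measure M {\<omega> \<in> space M. x \<le> \<bar>B \<omega> t - B \<omega> s\<bar>} \<le> 2 * exp (- (x^2) / (2 * (t - s)))"
proof -
  have M: "prob_space M" using BM by (simp add: two_sided_BM_def)
  have "\<forall>i < length [s, t] - 1. distributed M lborel (\<lambda>\<omega>. B \<omega> ([s, t] ! Suc i) - B \<omega> ([s, t] ! i))
      (\<lambda>x. ennreal (normal_density 0 (sqrt ([s, t] ! Suc i - [s, t] ! i)) x))"
  proof -
    have "\<forall>ts. sorted_wrt (<) ts \<longrightarrow>
        (\<forall>i < length ts - 1. distributed M lborel (\<lambda>\<omega>. B \<omega> (ts ! Suc i) - B \<omega> (ts ! i))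
          (\<lambda>x. ennreal (normal_density 0 (sqrt (ts ! Suc i - ts ! i)) x)))"
      using BM by (simp add: two_sided_BM_def)
    moreover have "sorted_wrt (<) [s, t]" using st by simp
    ultimately show ?thesis by blast
  qed
  then have "distributed M lborel (\<lambda>\<omega>. B \<omega> t - B \<omega> s)
      (\<lambda>x. ennreal (normal_density 0 (sqrt (t - s)) x))"
    by simp
  from normal_tail_abs[OF M _ x this] show ?thesis using st by simp
qed

text \<open>Chaining on the block of length 2^N comparable to 1 + |t|, with D = 4 R 2^N, gives 16 R
  2^N, and 2^N \<le> 2 (1 + |t|). The sign \<sigma> selects the half-line.\<close>

lemma linear_growth_of_increments:
  fixes b :: "real \<Rightarrow> real"
  assumes cont: "continuous_on UNIV b" and b0: "b 0 = 0" and R: "0 \<le> R"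
    and incr: "\<And>\<sigma> N n k. \<bar>\<sigma>\<bar> = 1 \<Longrightarrow> k < 2^n \<Longrightarrow>
      \<bar>b (\<sigma> * 2^N * (real (Suc k) / 2^n)) - b (\<sigma> * 2^N * (real k / 2^n))\<bar> \<le> 4 * R * 2^N * (3/4)^n"
  shows "\<bar>b t\<bar> \<le> 32 * R * (1 + \<bar>t\<bar>)"
proof -
  have scale: "\<exists>N. \<bar>t\<bar> \<le> 2^N \<and> 2^N \<le> 2 * (1 + \<bar>t\<bar>)"
  proof -
    define N where "N = nat \<lceil>log 2 (1 + \<bar>t\<bar>)\<rceil>"
    have pos: "0 \<le> log 2 (1 + \<bar>t\<bar>)" by (simp add: zero_le_log_cancel_iff)
    have N: "log 2 (1 + \<bar>t\<bar>) \<le> real N" "real N \<le> log 2 (1 + \<bar>t\<bar>) + 1"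
      using pos unfolding N_def by linarith+
    have "1 + \<bar>t\<bar> \<le> 2 powr real N" using N(1) by (subst (asm) log_le_iff) auto
    moreover have "2 powr real N \<le> 2 powr (log 2 (1 + \<bar>t\<bar>) + 1)" using N(2) by (intro powr_mono) auto
    ultimately have "1 + \<bar>t\<bar> \<le> 2^N" "2^N \<le> 2 * (1 + \<bar>t\<bar>)"
      by (simp_all add: powr_add powr_realpow)
    then show ?thesis by (intro exI[of _ N]) auto
  qed
  then obtain N where N: "\<bar>t\<bar> \<le> 2^N" "2^N \<le> 2 * (1 + \<bar>t\<bar>)" by blast
  define \<sigma> :: real where "\<sigma> = (if 0 \<le> t then 1 else - 1)"
  have \<sigma>: "\<bar>\<sigma>\<bar> = 1" "\<sigma> * \<bar>t\<bar> = t" by (auto simp: \<sigma>_def)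
  have "\<bar>b (\<sigma> * 2^N * (\<bar>t\<bar> / 2^N))\<bar> \<le> 4 * (4 * R * 2^N)"
  proof (rule dyadic_sup_bound[of "\<lambda>u. b (\<sigma> * 2^N * u)"])
    show "continuous_on {0..1} (\<lambda>u. b (\<sigma> * 2^N * u))"
      by (intro continuous_on_compose2[OF cont] continuous_intros) auto
  qed (use b0 R incr[OF \<sigma>(1)] N in auto)
  then have "\<bar>b t\<bar> \<le> 16 * R * 2^N" using \<sigma> by (simp add: ac_simps)
  also have "\<dots> \<le> 16 * R * (2 * (1 + \<bar>t\<bar>))" using N R by (intro mult_left_mono) auto
  finally show ?thesis by (simp add: algebra_simps)
qed

text \<open>Applied first over levels n and then over scales N; the constant grows from 4 to 8 to
  16.\<close>

lemma (in finite_measure) measure_UN_le_geometric: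
  fixes A :: "nat \<Rightarrow> 'a set"
  assumes A: "\<And>i. A i \<in> sets M" and le: "\<And>i. measure M (A i) \<le> c * (1/2)^i"
  shows "measure M (\<Union>i. A i) \<le> 2 * c"
proof -
  have s: "summable (\<lambda>i. c * (1/2 :: real)^i)"
    by (intro summable_mult summable_geometric) auto
  have s': "summable (\<lambda>i. measure M (A i))"
    by (rule summable_comparison_test_ev[OF _ s]) (use le in auto)
  have "measure M (\<Union>i. A i) \<le> (\<Sum>i. measure M (A i))"
    by (rule finite_measure_subadditive_countably) (use A s' in auto)
  also have "\<dots> \<le> (\<Sum>i. c * (1/2)^i)" by (rule suminf_le[OF le s' s])
  also have "\<dots> = 2 * c" by (simp add: suminf_mult summable_geometric suminf_geometric)
  finally show ?thesis .
qed

text \<open>Union bound over all scales, levels and grid intervals. The ratio 3/4 lies between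
  2^(-1/2), the decay of the standard deviation per level, and 1: thresholds stay summable, yet in
  units of the standard deviation they grow geometrically.\<close>

lemma two_sided_BM_growth:
  assumes BM: "two_sided_BM M B" and R: "0 < R" "2 \<le> R^2"
  obtains A where "A \<in> sets M" "measure M A \<le> 16 * exp (- (R^2))"
    "AE \<omega> in M. \<omega> \<notin> A \<longrightarrow> continuous_on UNIV (B \<omega>) \<and> (\<forall>t. \<bar>B \<omega> t\<bar> \<le> 32 * R * (1 + \<bar>t\<bar>))"
proof -
  interpret prob_space M using BM by (simp add: two_sided_BM_def)
  have meas[measurable]: "(\<lambda>\<omega>. B \<omega> t) \<in> borel_measurable M" for t
    using BM by (simp add: two_sided_BM_def)
  define E where "E N n i = {\<omega> \<in> space M. 4 * R * 2^N * (3/4)^n \<le>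
    \<bar>B \<omega> (fst i * 2^N * (real (Suc (snd i)) / 2^n)) - B \<omega> (fst i * 2^N * (real (snd i) / 2^n))\<bar>}"
    for N n :: nat and i :: "real \<times> nat"
  define I where "I n = {1, - 1 :: real} \<times> {..<2^n :: nat}" for n :: nat
  have E_sets: "E N n i \<in> sets M" for N n i unfolding E_def by measurable
  \<comment> \<open>A factor 1/4 per level outweighs the doubling of the number of intervals and
    leaves (1/2)^n.\<close>
  have exp_le: "exp (- (R^2)) \<le> 1 / 4"
  proof -
    have "exp (- (R^2)) \<le> exp (- 2)" using R by simp
    also have "\<dots> = 1 / (exp 1 * exp (1 :: real))"
      by (simp add: exp_minus exp_add[symmetric] inverse_eq_divide)
    also have "\<dots> \<le> 1 / (2 * 2)"
      using exp_ge_add_one_self[of 1] by (intro divide_left_mono mult_mono) auto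
    finally show ?thesis by simp
  qed
  have tail: "measure M (E N n i) \<le> 2 * exp (- (R^2)) * (1/4)^(n + N)" if i: "i \<in> I n" for N n i
  proof -
    obtain \<sigma> k where ik: "i = (\<sigma>, k)" "\<sigma> = 1 \<or> \<sigma> = - 1" using i by (auto simp: I_def)
    define x where "x = 4 * R * 2^N * (3/4)^n"
    define s t where "s = 2^N * (real k / 2^n)" and "t = 2^N * (real (Suc k) / 2^n)"
    have st: "s < t" "t - s = 2^N / 2^n"
      by (auto simp: s_def t_def field_simps)
    have x: "0 < x" using R by (simp add: x_def)
    have "measure M (E N n i) \<le> 2 * exp (- (x^2) / (2 * (t - s)))"
    proof -
      have E: "E N n i = {\<omega> \<in> space M. x \<le> \<bar>B \<omega> (\<sigma> * t) - B \<omega> (\<sigma> * s)\<bar>}"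
        by (simp only: E_def ik x_def s_def t_def mult.assoc fst_conv snd_conv)
      \<comment> \<open>For \<sigma> = - 1 the increment runs from - t to - s.\<close>
      have "measure M {\<omega> \<in> space M. x \<le> \<bar>B \<omega> (- s) - B \<omega> (- t)\<bar>}
          \<le> 2 * exp (- (x^2) / (2 * (t - s)))"
        using two_sided_BM_increment_tail[OF BM, of "- t" "- s" x] st(1) x by simp
      then show ?thesis
        unfolding E using ik(2) two_sided_BM_increment_tail[OF BM st(1) x]
        by (auto simp: abs_minus_commute)
    qed
    moreover have "x^2 / (2 * (t - s)) = R^2 * (2^N * (8 * (9/8)^n))"
    proof -
      have "(9/16 :: real)^n = (3/4)^n * (3/4)^n" by (simp flip: power_mult_distrib)
      then have "x^2 = 16 * R^2 * (2^N * 2^N) * (9/16)^n"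
        by (simp add: x_def power2_eq_square)
      moreover have "(9/8 :: real)^n = (9/16)^n * 2^n" by (simp flip: power_mult_distrib)
      ultimately show ?thesis unfolding st by (simp add: field_simps)
    qed
    moreover have "exp (- (R^2 * (2^N * (8 * (9/8)^n)))) \<le> exp (- (R^2)) * (1/4) ^ (n + N)"
    proof -
      have "1 + real N \<le> 2^N"
        using Bernoulli_inequality[of 1 N] by simp
      \<comment> \<open>The factor 8 comes from the 4 in the threshold, squared and halved; it
        offsets the slow rate 9/8 in the Bernoulli inequality.\<close>
      moreover have "1 + real n \<le> 8 * (9/8)^n"
        using Bernoulli_inequality[of "1/8 :: real" n] by simp
      ultimately have "(1 + real N) * (1 + real n) \<le> 2^N * (8 * (9/8)^n)"
        by (intro mult_mono) auto
      moreover have "1 + real (n + N) \<le> (1 + real N) * (1 + real n)"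
        by (simp add: algebra_simps)
      ultimately have "1 + real (n + N) \<le> 2^N * (8 * (9/8)^n)" by linarith
      then have "R^2 * (1 + real (n + N)) \<le> R^2 * (2^N * (8 * (9/8)^n))"
        by (intro mult_left_mono) auto
      then have "exp (- (R^2 * (2^N * (8 * (9/8)^n)))) \<le> exp (- (R^2 * (1 + real (n + N))))"
        by simp
      also have "\<dots> = exp (- (R^2)) * exp (- (R^2)) ^ (n + N)"
        by (simp add: exp_of_nat_mult[symmetric] exp_add[symmetric] algebra_simps)
      also have "\<dots> \<le> exp (- (R^2)) * (1/4) ^ (n + N)"
        using exp_le by (intro mult_left_mono power_mono) auto
      finally show ?thesis .
    qed
    ultimately show ?thesis by simp
  qed
  have level: "measure M (\<Union>i\<in>I n. E N n i) \<le> 4 * exp (- (R^2)) * (1/2)^N * (1/2)^n" for N n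
  proof -
    have "measure M (\<Union>i\<in>I n. E N n i) \<le> (\<Sum>i\<in>I n. measure M (E N n i))"
      by (rule finite_measure_subadditive_finite) (use E_sets in \<open>auto simp: I_def\<close>)
    also have "\<dots> \<le> (\<Sum>i\<in>I n. 2 * exp (- (R^2)) * (1/4)^(n + N))"
      by (intro sum_mono tail)
    also have "\<dots> = real (card (I n)) * (2 * exp (- (R^2)) * (1/4)^(n + N))" by simp
    also have "real (card (I n)) = 2 * 2^n" by (simp add: I_def card_cartesian_product)
    also have "2 * 2^n * (2 * exp (- (R^2)) * (1/4)^(n + N)) =
        4 * exp (- (R^2)) * (2^n * (1/4)^n) * (1/4)^N"
      by (simp add: power_add)
    also have "2^n * (1/4)^n = (1/2 :: real)^n" by (simp flip: power_mult_distrib)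
    also have "4 * exp (- (R^2)) * (1/2)^n * (1/4)^N \<le> 4 * exp (- (R^2)) * (1/2)^n * (1/2)^N"
      by (intro mult_left_mono power_mono) auto
    finally show ?thesis by (simp add: ac_simps)
  qed
  define A where "A = (\<Union>N. \<Union>n. \<Union>i\<in>I n. E N n i)"
  have I_fin: "finite (I n)" for n by (simp add: I_def)
  have sets1: "(\<Union>i\<in>I n. E N n i) \<in> sets M" for N n
    using E_sets I_fin by (intro sets.finite_UN) auto
  have sets2: "(\<Union>n. \<Union>i\<in>I n. E N n i) \<in> sets M" for N
    using sets1 by (intro sets.countable_UN) auto
  have "measure M (\<Union>n. \<Union>i\<in>I n. E N n i) \<le> 8 * exp (- (R^2)) * (1/2)^N" for N
    using measure_UN_le_geometric[OF sets1 level] by (simp add: mult.assoc)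
  from measure_UN_le_geometric[OF sets2 this]
  have "measure M A \<le> 2 * (8 * exp (- (R^2)))"
    unfolding A_def .
  moreover have "A \<in> sets M"
    unfolding A_def using sets2 by (intro sets.countable_UN) auto
  moreover have "AE \<omega> in M. \<omega> \<notin> A \<longrightarrow>
      continuous_on UNIV (B \<omega>) \<and> (\<forall>t. \<bar>B \<omega> t\<bar> \<le> 32 * R * (1 + \<bar>t\<bar>))"
  proof -
    have "AE \<omega> in M. B \<omega> 0 = 0 \<and> continuous_on UNIV (B \<omega>)"
      using BM by (simp add: two_sided_BM_def)
    then show ?thesis using AE_space
    proof eventually_elim
      case (elim \<omega>)
      show ?case
      proof (intro impI conjI allI)
        fix t assume \<omega>: "\<omega> \<notin> A"
        show "\<bar>B \<omega> t\<bar> \<le> 32 * R * (1 + \<bar>t\<bar>)"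
        proof (rule linear_growth_of_increments)
          fix \<sigma> :: real and N n k :: nat assume "\<bar>\<sigma>\<bar> = 1" "k < 2^n"
          then have "(\<sigma>, k) \<in> I n" by (auto simp: I_def)
          then have "\<omega> \<notin> E N n (\<sigma>, k)" using \<omega> unfolding A_def by blast
          then show "\<bar>B \<omega> (\<sigma> * 2^N * (real (Suc k) / 2^n)) - B \<omega> (\<sigma> * 2^N * (real k / 2^n))\<bar>
              \<le> 4 * R * 2^N * (3/4)^n"
            using elim by (simp add: E_def)
        qed (use elim R in auto)
      qed (use elim in auto)
    qed
  qed
  ultimately show ?thesis using that by simp
qed

section \<open>Tail bounds\<close>

lemma invelope_tail:
  fixes X :: "(real \<Rightarrow> real) \<Rightarrow> (real \<Rightarrow> real) \<Rightarrow> real"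
  assumes BM: "two_sided_BM M B" and n: "even n"
    and inv: "AE \<omega> in M. invelope (Yproc (n + 2) (B \<omega>)) (H \<omega>)"
    and X: "\<And>b h R. 1 \<le> R \<Longrightarrow> continuous_on UNIV b \<Longrightarrow> (\<And>t. \<bar>b t\<bar> \<le> R * (1 + \<bar>t\<bar>)) \<Longrightarrow>
      invelope (Yproc (n + 2) b) h \<Longrightarrow> X b h \<le> 10^9 * R^2"
    and t: "0 < t"
  shows "measure M {\<omega> \<in> space M. t < X (B \<omega>) (H \<omega>)} \<le> 2048 * 10^9 * exp (- t / (2048 * 10^9))"
proof -
  interpret prob_space M using BM by (simp add: two_sided_BM_def)
  define L :: real where "L = 2048 * 10^9"
  have L: "0 < L" "16 \<le> L" by (simp_all add: L_def)
  have "measure M {\<omega> \<in> space M. t < X (B \<omega>) (H \<omega>)} \<le> L * exp (- t / L)"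
  \<comment> \<open>For t \<le> L the bound exceeds 1 because L / 3 does. For larger t the factor 2
    in L = 2 * 1024 * 10^9 ensures R^2 \<ge> 2.\<close>
  proof (cases "t \<le> L")
    case True
    have "1 \<le> L * (1 / 3)" using L by (simp add: L_def)
    also have "1 / 3 \<le> exp (- 1 :: real)" using exp_le by (simp add: exp_minus field_simps)
    then have "L * (1 / 3) \<le> L * exp (- 1)" using L by simp
    also have "\<dots> \<le> L * exp (- t / L)" using True L by simp
    finally show ?thesis using prob_le_1 order_trans by blast
  next
    case False
    \<comment> \<open>Solves 10^9 (32 R)^2 = t, where 32 R is the growth constant outside the
      exceptional set.\<close>
    define R where "R = sqrt (t / (1024 * 10^9))"
    have R2: "R^2 = t / (1024 * 10^9)" using t by (simp add: R_def)
    have R: "0 < R" "2 \<le> R^2" using t False by (simp add: R_def) (use False in \<open>simp add: R2 L_def\<close>)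
    have "1 \<le> R" using R by (smt (verit) power_le_one)
    obtain A where A: "A \<in> sets M" "measure M A \<le> 16 * exp (- (R^2))"
      "AE \<omega> in M. \<omega> \<notin> A \<longrightarrow> continuous_on UNIV (B \<omega>) \<and> (\<forall>t. \<bar>B \<omega> t\<bar> \<le> 32 * R * (1 + \<bar>t\<bar>))"
      using two_sided_BM_growth[OF BM R] by blast
    have "AE \<omega> in M. \<omega> \<in> {\<omega> \<in> space M. t < X (B \<omega>) (H \<omega>)} \<longrightarrow> \<omega> \<in> A"
      using A(3) inv
    proof eventually_elim
      case (elim \<omega>)
      have "X (B \<omega>) (H \<omega>) \<le> t" if "\<omega> \<notin> A"
      proof -
        have "X (B \<omega>) (H \<omega>) \<le> 10^9 * (32 * R)^2"
          using elim that \<open>1 \<le> R\<close> by (intro X) auto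
        also have "\<dots> = t" by (simp add: power_mult_distrib R2)
        finally show ?thesis .
      qed
      then show ?case by force
    qed
    then have "measure M {\<omega> \<in> space M. t < X (B \<omega>) (H \<omega>)} \<le> measure M A"
      using A(1) by (rule finite_measure_mono_AE)
    also note A(2)
    also have "16 * exp (- (R^2)) \<le> L * exp (- t / L)"
      using L t by (intro mult_mono) (auto simp: R2 L_def field_simps)
    finally show ?thesis .
  qed
  then show ?thesis by (simp add: L_def)
qed

theorem theorem4p1:
  shows "\<exists>L>0. \<exists>b>0. \<forall>(\<alpha>::nat) (M::'a measure) B H.
    even \<alpha> \<and> \<alpha> \<ge> 2 \<and> two_sided_BM M B \<and>
    (AE \<omega> in M. invelope (Yproc \<alpha> (B \<omega>)) (H \<omega>)) \<and>
    (\<lambda>\<omega>. deriv2 (H \<omega>) 0) \<in> borel_measurable M \<and>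
    (\<lambda>\<omega>. deriv3 (H \<omega>) 0) \<in> borel_measurable M \<and>
    (\<lambda>\<omega>. hminus (Yproc \<alpha> (B \<omega>)) (H \<omega>)) \<in> borel_measurable M \<and>
    (\<lambda>\<omega>. hplus (Yproc \<alpha> (B \<omega>)) (H \<omega>)) \<in> borel_measurable M
    \<longrightarrow> (\<forall>t>0.
      max (max (measure M {\<omega> \<in> space M. \<bar>deriv2 (H \<omega>) 0\<bar> > t})
               (measure M {\<omega> \<in> space M. \<bar>deriv3 (H \<omega>) 0\<bar> > t}))
          (max (measure M {\<omega> \<in> space M. hminus (Yproc \<alpha> (B \<omega>)) (H \<omega>) > t})
               (measure M {\<omega> \<in> space M. hplus (Yproc \<alpha> (B \<omega>)) (H \<omega>) > t}))
      \<le> L * exp (- (t powr b) / L))"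
proof -
  have "max (max (measure M {\<omega> \<in> space M. \<bar>deriv2 (H \<omega>) 0\<bar> > t})
               (measure M {\<omega> \<in> space M. \<bar>deriv3 (H \<omega>) 0\<bar> > t}))
          (max (measure M {\<omega> \<in> space M. hminus (Yproc \<alpha> (B \<omega>)) (H \<omega>) > t})
               (measure M {\<omega> \<in> space M. hplus (Yproc \<alpha> (B \<omega>)) (H \<omega>) > t}))
      \<le> 2048 * 10^9 * exp (- (t powr 1) / (2048 * 10^9))"
    if \<alpha>: "even \<alpha>" "2 \<le> \<alpha>" and BM: "two_sided_BM M B"
      and inv: "AE \<omega> in M. invelope (Yproc \<alpha> (B \<omega>)) (H \<omega>)" and t: "0 < t"
    for \<alpha> :: nat and M :: "'a measure" and B H t
  proof -
    \<comment> \<open>Writing the exponent \<alpha> + 2 as n + 4 makes its fourth derivative a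
      multiple of t^n.\<close>
    define n where "n = \<alpha> - 2"
    have n: "\<alpha> = n + 2" "even n" using \<alpha> by (auto simp: n_def)
    note tail = invelope_tail[OF BM n(2) inv[unfolded n(1)] _ t]
    have "measure M {\<omega> \<in> space M. t < \<bar>deriv2 (H \<omega>) 0\<bar>} \<le> 2048 * 10^9 * exp (- t / (2048 * 10^9))"
      by (rule tail[of "\<lambda>b h. \<bar>deriv2 h 0\<bar>"]) (rule invelope_bounds(1)[OF n(2)])
    moreover have "measure M {\<omega> \<in> space M. t < \<bar>deriv3 (H \<omega>) 0\<bar>} \<le> 2048 * 10^9 * exp (- t / (2048 * 10^9))"
      by (rule tail[of "\<lambda>b h. \<bar>deriv3 h 0\<bar>"]) (rule invelope_bounds(2)[OF n(2)])
    moreover have "measure M {\<omega> \<in> space M. t < hminus (Yproc (n + 2) (B \<omega>)) (H \<omega>)}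
        \<le> 2048 * 10^9 * exp (- t / (2048 * 10^9))"
      by (rule tail[of "\<lambda>b h. hminus (Yproc (n + 2) b) h"]) (rule invelope_bounds(3)[OF n(2)])
    moreover have "measure M {\<omega> \<in> space M. t < hplus (Yproc (n + 2) (B \<omega>)) (H \<omega>)}
        \<le> 2048 * 10^9 * exp (- t / (2048 * 10^9))"
      by (rule tail[of "\<lambda>b h. hplus (Yproc (n + 2) b) h"]) (rule invelope_bounds(4)[OF n(2)])
    moreover have "t powr 1 = t" using t by simp
    ultimately show ?thesis
      unfolding n(1) max.bounded_iff by (simp only: conj_absorb)
  qed
  moreover have "0 < (2048 * 10^9 :: real)" "0 < (1 :: real)" by simp_all
  ultimately show ?thesis by blast
qed

end
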